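(* Let $b\in(0,\infty)\cup\{\infty\}$ and suppose that $q\in L^1_{\mathrm{loc}}((0,b);dx)$ is real-valued a.e. on $(0,b)$. For $\alpha\in\mathbb{R}$ let $$\tau_\alpha=-\frac{d}{dx}x^\alpha\frac{d}{dx}+q(x)\quad\text{for a.e. } x\in(0,b).$$ (i) Let $\alpha\in\mathbb{R}$ and assume that for a.e. $x>0$ sufficiently small, $$q(x)\ge\Big[\tfrac34-\tfrac{\alpha}{2}\Big]x^{\alpha-2}.$$ Then $\tau_\alpha$ is nonoscillatory and in the limit point case at $x=0$. (ii) Let $\alpha\in(-\infty,2)$ and assume there exist $N\in\mathbb{N}$ and $\varepsilon>0$ such that for a.e. $x>0$ sufficiently small (depending on $N$ and $\varepsilon$), $$q(x)\ge\Big[\tfrac34-\tfrac{\alpha}{2}\Big]x^{\alpha-2}-\tfrac12(2-\alpha)x^{\alpha-2}\sum_{j=1}^{N}\prod_{\ell=1}^{j}[\ln_\ell(x)]^{-1}+\Big[\tfrac34+\varepsilon\Big]x^{\alpha-2}[\ln_1(x)]^{-2}.$$ Then $\tau_\alpha$ is nonoscillatory and in the limit point case at $x=0$.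
   Context: Here $\mathbb{N}=\{1,2,\dots\}$. Iterated logarithms: for $x>0$ sufficiently small, $\ln_1(x)=|\ln(x)|=\ln(1/x)$ and $\ln_{j+1}(x)=\ln(\ln_j(x))$, $j\in\mathbb{N}$; $x$ is taken so small that $\ln_1(x),\dots,\ln_N(x)$ are strictly positive. A solution of $\tau_\alpha u=zu$ ($z\in\mathbb{C}$) is a function $u$ with $u$ and $x^\alpha u'$ locally absolutely continuous on $(0,b)$ satisfying $-(x^\alpha u')'+qu=zu$ a.e. on $(0,b)$. Limit circle/limit point (Weyl's alternative): $\tau_\alpha$ is in the limit circle case at $0$ if for every $z\in\mathbb{C}$ all solutions $u$ of $\tau_\alpha u=zu$ lie in $L^2$ near $0$, that is, in $L^2((0,c);dx)$ for $c\in(0,b)$. It is in the limit point case at $0$ if for every $z\in\mathbb{C}$ there exists at least one solution of $\tau_\alpha u=zu$ that is not in $L^2$ near $0$. Exactly one of the two cases holds. Nonoscillatory: $\tau_\alpha$ is nonoscillatory at $0$ if there is a real-valued solution $u$ (not identically zero) of $\tau_\alpha u=0$ that has finitely many zeros in $(0,c)$, for fixed $c\in(0,b)$ (equivalently, every nontrivial real-valued solution has this property). *)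

theory Defs
  imports "HOL-Analysis.Analysis"
begin

text \<open>The interval \<open>(0,b)\<close> with \<open>0 < b \<le> \<infinity>\<close> is \<open>einterval 0 b\<close> for \<open>b :: ereal\<close>.\<close>

definition locally_L1_on :: "real set \<Rightarrow> (real \<Rightarrow> complex) \<Rightarrow> bool" where
  "locally_L1_on S f \<longleftrightarrow> (\<forall>K. compact K \<and> K \<subseteq> S \<longrightarrow> f absolutely_integrable_on K)"

text \<open>The usual \<open>\<epsilon>\<close>-\<open>\<delta>\<close> notion: \<open>D\<close> ranges over the finite families of nonoverlapping
  compact subintervals \<open>K = [Inf K, Sup K]\<close> of \<open>S\<close>.\<close>

definition abs_continuous_on :: "real set \<Rightarrow> (real \<Rightarrow> complex) \<Rightarrow> bool" where
  "abs_continuous_on S f \<longleftrightarrow>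
     (\<forall>\<epsilon>>0. \<exists>\<delta>>0. \<forall>D T. D division_of T \<and> T \<subseteq> S \<and> (\<Sum>K\<in>D. Sup K - Inf K) < \<delta> \<longrightarrow>
        (\<Sum>K\<in>D. norm (f (Sup K) - f (Inf K))) < \<epsilon>)"

definition locally_abs_continuous_on :: "real set \<Rightarrow> (real \<Rightarrow> complex) \<Rightarrow> bool" where
  "locally_abs_continuous_on S f \<longleftrightarrow> (\<forall>c d. {c..d} \<subseteq> S \<longrightarrow> abs_continuous_on {c..d} f)"

definition quasi_deriv :: "real \<Rightarrow> (real \<Rightarrow> complex) \<Rightarrow> real \<Rightarrow> complex" where
  "quasi_deriv \<alpha> u x = (x powr \<alpha>) *\<^sub>R vector_derivative u (at x)"

text \<open>Solutions of \<open>- (x\<^sup>\<alpha> u')' + q u = z u\<close> on \<open>(0,b)\<close>. Since \<open>x\<^sup>\<alpha> u'\<close> is required to be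
  (locally absolutely) continuous, a solution is continuously differentiable. The explicit
  differentiability clause excludes points at which \<open>vector_derivative\<close> would be unspecified.\<close>

definition is_solution ::
  "real \<Rightarrow> (real \<Rightarrow> complex) \<Rightarrow> ereal \<Rightarrow> complex \<Rightarrow> (real \<Rightarrow> complex) \<Rightarrow> bool" where
  "is_solution \<alpha> q b z u \<longleftrightarrow>
     locally_abs_continuous_on (einterval 0 b) u \<and>
     (\<forall>x\<in>einterval 0 b. u differentiable (at x)) \<and>
     locally_abs_continuous_on (einterval 0 b) (quasi_deriv \<alpha> u) \<and>
     (AE x in lebesgue. x \<in> einterval 0 b \<longrightarrow>
        (\<exists>D. (quasi_deriv \<alpha> u has_vector_derivative D) (at x) \<and> - D + q x * u x = z * u x))"

text \<open>For \<open>u\<close> continuous on \<open>(0,b)\<close>, square integrability on \<open>(0,c)\<close> does not depend on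
  \<open>c \<in> (0,b)\<close>.\<close>

definition L2_near_0 :: "ereal \<Rightarrow> (real \<Rightarrow> complex) \<Rightarrow> bool" where
  "L2_near_0 b u \<longleftrightarrow>
     (\<exists>c\<in>einterval 0 b. u \<in> borel_measurable (lebesgue_on {0<..<c}) \<and>
        integrable (lebesgue_on {0<..<c}) (\<lambda>x. (norm (u x))\<^sup>2))"

definition limit_point_at_0 :: "real \<Rightarrow> (real \<Rightarrow> complex) \<Rightarrow> ereal \<Rightarrow> bool" where
  "limit_point_at_0 \<alpha> q b \<longleftrightarrow> (\<forall>z. \<exists>u. is_solution \<alpha> q b z u \<and> \<not> L2_near_0 b u)"

text \<open>The zeros of a nontrivial solution do not accumulate in \<open>(0,b)\<close>, so the choice of
  \<open>c \<in> (0,b)\<close> is again immaterial.\<close>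

definition nonoscillatory_at_0 :: "real \<Rightarrow> (real \<Rightarrow> complex) \<Rightarrow> ereal \<Rightarrow> bool" where
  "nonoscillatory_at_0 \<alpha> q b \<longleftrightarrow>
     (\<exists>u. is_solution \<alpha> q b 0 u \<and>
          (\<forall>x\<in>einterval 0 b. u x \<in> \<real>) \<and>
          (\<exists>x\<in>einterval 0 b. u x \<noteq> 0) \<and>
          (\<forall>c\<in>einterval 0 b. finite {x\<in>{0<..<c}. u x = 0}))"

text \<open>The iterated logarithms \<open>ln\<^sub>j\<close>, \<open>j \<ge> 1\<close>, for small \<open>x > 0\<close>; index \<open>0\<close> serves only to start
  the recursion, so that \<open>ln\<^sub>1 x = ln (1/x)\<close>, which is \<open>\<bar>ln x\<bar>\<close> for \<open>0 < x < 1\<close>.\<close>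

primrec iter_ln :: "nat \<Rightarrow> real \<Rightarrow> real" where
  "iter_ln 0 x = 1 / x"
| "iter_ln (Suc j) x = ln (iter_ln j x)"

definition ae_near_0 :: "(real \<Rightarrow> bool) \<Rightarrow> bool" where
  "ae_near_0 P \<longleftrightarrow> (\<exists>\<delta>>0. AE x in lebesgue. 0 < x \<and> x < \<delta> \<longrightarrow> P x)"

end

theory Submission
  imports Defs
begin

text \<open>
  Write \<open>ln\<^sub>l\<close> for the iterated logarithms, \<open>P\<^sub>j = 1 / (ln\<^sub>1 \<cdots> ln\<^sub>j)\<close> and \<open>S = P\<^sub>1 + \<dots> + P\<^sub>N\<close>.
  The function \<open>f = (x ln\<^sub>1 \<cdots> ln\<^sub>N) powr (- 1/2)\<close> is a positive solution of
  \<open>- (x powr \<alpha> f')' + Q f = 0\<close> for the explicit potential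
  \<open>Q = x powr (\<alpha> - 2) (3/4 - \<alpha>/2 - 1/2 (2 - \<alpha>) S + 1/2 S\<^sup>2 + 1/4 (P\<^sub>1\<^sup>2 + \<dots> + P\<^sub>N\<^sup>2))\<close>, and it is not
  square integrable near \<open>0\<close> since \<open>f\<^sup>2\<close> is minus the derivative of \<open>ln\<^sub>N\<^sub>+\<^sub>1\<close>, which tends to
  infinity at \<open>0\<close>. For \<open>N = 0\<close> the potential \<open>Q\<close> is the lower bound in (i). For \<open>N \<ge> 1\<close> the two
  quadratic terms are asymptotic to \<open>3/4 P\<^sub>1\<^sup>2\<close>, because \<open>P\<^sub>j = o(P\<^sub>1)\<close> for \<open>j \<ge> 2\<close>; hence \<open>Q\<close> lies
  below the bound in (ii) near \<open>0\<close> (\<open>comparison_potential_le\<close>). In both cases \<open>q \<ge> Q\<close> near \<open>0\<close>.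

  Let \<open>u\<close> be the real solution of \<open>\<tau> u = 0\<close> with the Cauchy data of \<open>f\<close> at a small \<open>c\<close>. The
  Wronskian \<open>W = x powr \<alpha> (f u' - f' u)\<close> vanishes at \<open>c\<close> and has the derivative \<open>(q - Q) f u\<close>,
  which is nonnegative as long as \<open>u\<close> is. So \<open>W \<le> 0\<close> to the left of \<open>c\<close>, the quotient \<open>u / f\<close>
  is decreasing there, and \<open>u \<ge> f > 0\<close> on all of \<open>(0, c]\<close> (\<open>comparison\<close>). This solution has no
  zeros near \<open>0\<close> and is not square integrable near \<open>0\<close>.

  It remains to pass from \<open>z = 0\<close> to arbitrary complex \<open>z\<close> (\<open>limit_point_of_non_L2_solution\<close>).
  If all solutions of \<open>\<tau> u = z u\<close> were square integrable near \<open>0\<close>, variation of constants would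
  express \<open>u\<close> through two of them with coefficients solving a linear system whose matrix is
  integrable up to \<open>0\<close>; the coefficients would be bounded and \<open>u\<close> would be square integrable.

  Since \<open>q\<close> is merely locally integrable, derivatives exist only almost everywhere. The arguments
  are therefore carried out with integrated equations: \<open>primitive_on I F f\<close> says that increments of
  \<open>F\<close> are integrals of \<open>f\<close>. The ingredients are the product rule for such primitives
  (\<open>primitive_on_bilinear\<close>), the Picard series and the Gronwall bound for linear systems
  (locale \<open>linear_equation\<close>), and the return to the pointwise notion of solution through
  Lebesgue's differentiation theorem (\<open>solution_pair_is_solution\<close>).
\<close>

section \<open>Primitives of locally integrable functions\<close>

text \<open>
  For an interval \<open>I\<close> this is local integrability on \<open>I\<close>; for \<open>y < x\<close> the set \<open>{x..y}\<close> is
  empty and the condition trivial.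
\<close>

definition integrable_within :: "real set \<Rightarrow> (real \<Rightarrow> 'a::euclidean_space) \<Rightarrow> bool" where
  "integrable_within I f \<longleftrightarrow> (\<forall>x\<in>I. \<forall>y\<in>I. f absolutely_integrable_on {x..y})"

text \<open>
  The integrated form of "\<open>F\<close> is locally absolutely continuous with \<open>F' = f\<close> almost everywhere". It
  can be added, multiplied and passed to limits without any reference to derivatives.
\<close>

definition primitive_on ::
  "real set \<Rightarrow> (real \<Rightarrow> 'a::euclidean_space) \<Rightarrow> (real \<Rightarrow> 'a) \<Rightarrow> bool" where
  "primitive_on I F f \<longleftrightarrow> integrable_within I f \<and>
     (\<forall>x\<in>I. \<forall>y\<in>I. x \<le> y \<longrightarrow> F y - F x = integral {x..y} f)"

lemma Icc_subset_interval:
  fixes I :: "real set"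
  assumes "is_interval I" "x \<in> I" "y \<in> I"
  shows "{x..y} \<subseteq> I"
  using assms by (meson atLeastAtMost_iff mem_is_interval_1_I subsetI)

lemma open_interval_neighbourhood:
  fixes I :: "real set"
  assumes "open I" "is_interval I" "x \<in> I"
  obtains d where "d > 0" "{x - d..x + d} \<subseteq> I"
  using assms(1,3) by (metis cball_eq_atLeastAtMost open_contains_cball)

lemma primitive_onD:
  assumes "primitive_on I F f" "x \<in> I" "y \<in> I" "x \<le> y"
  shows "F y - F x = integral {x..y} f"
  using assms by (auto simp: primitive_on_def)

lemma primitive_on_integrable:
  assumes "primitive_on I F f" "x \<in> I" "y \<in> I"
  shows "f absolutely_integrable_on {x..y}" "f integrable_on {x..y}"
  using assms by (auto simp: primitive_on_def integrable_within_def
      intro: absolutely_integrable_imp_integrable set_lebesgue_integral_eq_integral(1))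

lemma primitive_on_integrable_within: "primitive_on I F f \<Longrightarrow> integrable_within I f"
  by (simp add: primitive_on_def)

lemma primitive_on_subset: "primitive_on I F f \<Longrightarrow> J \<subseteq> I \<Longrightarrow> primitive_on J F f"
  unfolding primitive_on_def integrable_within_def by (meson subsetD)

lemma integrable_within_cong:
  assumes "is_interval I" "\<And>t. t \<in> I \<Longrightarrow> f t = g t" "integrable_within I f"
  shows "integrable_within I g"
  unfolding integrable_within_def
proof (intro ballI)
  fix x y assume xy: "x \<in> I" "y \<in> I"
  then have "f absolutely_integrable_on {x..y}" using assms(3) by (auto simp: integrable_within_def)
  then show "g absolutely_integrable_on {x..y}"
    by (rule absolutely_integrable_spike[of _ _ "{}"])
      (use Icc_subset_interval[OF assms(1) xy] assms(2) in auto)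
qed

lemma primitive_on_cong:
  assumes "is_interval I" "\<And>t. t \<in> I \<Longrightarrow> F t = G t" "\<And>t. t \<in> I \<Longrightarrow> f t = g t"
    and "primitive_on I F f"
  shows "primitive_on I G g"
  unfolding primitive_on_def
proof (intro conjI ballI impI)
  show "integrable_within I g"
    using integrable_within_cong[OF assms(1,3)] assms(4) by (auto simp: primitive_on_def)
  fix x y assume xy: "x \<in> I" "y \<in> I" "x \<le> y"
  have "integral {x..y} f = integral {x..y} g"
    by (rule integral_cong) (use Icc_subset_interval[OF assms(1) xy(1,2)] assms(3) in auto)
  then show "G y - G x = integral {x..y} g"
    using primitive_onD[OF assms(4) xy] xy assms(2) by auto
qed

lemma primitive_on_spike:
  assumes "negligible N" "\<And>t. t \<in> I - N \<Longrightarrow> g t = f t" "is_interval I" "primitive_on I F f"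
  shows "primitive_on I F g"
  unfolding primitive_on_def integrable_within_def
proof (intro conjI ballI impI)
  fix x y assume xy: "x \<in> I" "y \<in> I"
  have eq: "g t = f t" if "t \<in> {x..y} - N" for t
    using that Icc_subset_interval[OF assms(3) xy] assms(2) by auto
  show "g absolutely_integrable_on {x..y}"
    by (rule absolutely_integrable_spike[OF primitive_on_integrable(1)[OF assms(4) xy] assms(1) eq])
  show "F y - F x = integral {x..y} g" if "x \<le> y"
    using primitive_onD[OF assms(4) xy that] integral_spike[OF assms(1), of "{x..y}" g f] eq by simp
qed

lemma primitive_on_exists:
  fixes f :: "real \<Rightarrow> 'a::euclidean_space"
  assumes "is_interval I" "c \<in> I" "integrable_within I f"
  obtains F where "primitive_on I F f" "F c = 0"
proof -
  define F where "F = (\<lambda>x. if c \<le> x then integral {c..x} f else - integral {x..c} f)"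
  have 0: "F c = 0" by (simp add: F_def)
  have int: "f integrable_on {x..y}" if "x \<in> I" "y \<in> I" for x y
    using assms(3) that by (auto simp: integrable_within_def intro: set_lebesgue_integral_eq_integral(1))
  have "primitive_on I F f"
    unfolding primitive_on_def
  proof (intro conjI ballI impI assms(3))
    fix x y assume xy: "x \<in> I" "y \<in> I" "x \<le> y"
    consider "c \<le> x" | "x < c" "c \<le> y" | "y < c" by linarith
    then show "F y - F x = integral {x..y} f"
    proof cases
      case 1
      then show ?thesis using Henstock_Kurzweil_Integration.integral_combine[OF 1 xy(3) int[OF assms(2) xy(2)]] xy(3)
        by (simp add: F_def algebra_simps)
    next
      case 2
      then show ?thesis using Henstock_Kurzweil_Integration.integral_combine[of x c y f] int[OF xy(1,2)] xy
        by (simp add: F_def algebra_simps)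
    next
      case 3
      then show ?thesis using Henstock_Kurzweil_Integration.integral_combine[of x y c f] int[OF xy(1) assms(2)] xy
        by (simp add: F_def algebra_simps)
    qed
  qed
  with 0 that show ?thesis by blast
qed

lemma primitive_on_continuous:
  fixes F :: "real \<Rightarrow> 'a::euclidean_space"
  assumes "open I" "is_interval I" "primitive_on I F f"
  shows "continuous_on I F"
proof -
  have "isCont F x" if x: "x \<in> I" for x
  proof -
    obtain d where d: "d > 0" "{x - d..x + d} \<subseteq> I"
      using open_interval_neighbourhood[OF assms(1,2) x] by blast
    then have I: "x - d \<in> I" "x + d \<in> I" by auto
    have "continuous_on {x - d..x + d} (\<lambda>y. F (x - d) + integral {x - d..y} f)"
      by (intro continuous_intros indefinite_integral_continuous_1 primitive_on_integrable[OF assms(3)] I)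
    moreover have "F (x - d) + integral {x - d..y} f = F y" if "y \<in> {x - d..x + d}" for y
      using primitive_onD[OF assms(3) I(1), of y] that d(2) by (auto simp: algebra_simps)
    ultimately have "continuous_on {x - d..x + d} F"
      by (rule continuous_on_eq)
    then have "continuous_on {x - d<..<x + d} F"
      by (rule continuous_on_subset) auto
    then show ?thesis
      using d(1) by (simp add: continuous_on_eq_continuous_at)
  qed
  then show ?thesis by (simp add: continuous_at_imp_continuous_on)
qed

lemma integrable_within_continuous:
  assumes "is_interval I" "continuous_on I f"
  shows "integrable_within I f"
  unfolding integrable_within_def
  by (intro ballI absolutely_integrable_continuous_real continuous_on_subset[OF assms(2)]
      Icc_subset_interval assms)

lemma primitive_on_of_derivative:
  fixes F :: "real \<Rightarrow> 'a::euclidean_space"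
  assumes "is_interval I" "\<And>t. t \<in> I \<Longrightarrow> (F has_vector_derivative f t) (at t)" "continuous_on I f"
  shows "primitive_on I F f"
  unfolding primitive_on_def
proof (intro conjI ballI impI integrable_within_continuous assms)
  fix x y assume xy: "x \<in> I" "y \<in> I" "x \<le> y"
  have "(f has_integral (F y - F x)) {x..y}"
  proof (rule fundamental_theorem_of_calculus[OF xy(3)])
    fix t assume "t \<in> {x..y}"
    then have "t \<in> I" using Icc_subset_interval[OF assms(1) xy(1,2)] by auto
    then show "(F has_vector_derivative f t) (at t within {x..y})"
      by (rule has_vector_derivative_at_within[OF assms(2)])
  qed
  then show "F y - F x = integral {x..y} f" by (simp add: integral_unique)
qed

lemma primitive_on_continuous_has_derivative:
  fixes F :: "real \<Rightarrow> 'a::euclidean_space"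
  assumes "open I" "is_interval I" "primitive_on I F f" "continuous_on I f" "x \<in> I"
  shows "(F has_vector_derivative f x) (at x)"
proof -
  obtain d where d: "d > 0" "{x - d..x + d} \<subseteq> I"
    using open_interval_neighbourhood[OF assms(1,2,5)] by blast
  then have I: "x - d \<in> I" by auto
  have eq: "F (x - d) + integral {x - d..y} f = F y" if "y \<in> {x - d..x + d}" for y
    using primitive_onD[OF assms(3) I(1), of y] that d(2) by (auto simp: algebra_simps)
  have "((\<lambda>y. integral {x - d..y} f) has_vector_derivative f x) (at x within {x - d..x + d})"
    by (rule integral_has_vector_derivative) (use d assms(4) continuous_on_subset in auto)
  then have "((\<lambda>y. F (x - d) + integral {x - d..y} f) has_vector_derivative f x) (at x within {x - d..x + d})"
    by (auto intro!: derivative_eq_intros)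
  then have "(F has_vector_derivative f x) (at x within {x - d..x + d})"
    by (rule has_vector_derivative_transform[rotated -1]) (use d eq in auto)
  then show ?thesis
    using d(1) by (simp add: at_within_Icc_at)
qed

lemma primitive_on_linear:
  fixes L :: "'a::euclidean_space \<Rightarrow> 'b::euclidean_space"
  assumes "bounded_linear L" "primitive_on I F f"
  shows "primitive_on I (\<lambda>t. L (F t)) (\<lambda>t. L (f t))"
  unfolding primitive_on_def integrable_within_def
proof (intro conjI ballI impI)
  interpret bounded_linear L by fact
  fix x y assume xy: "x \<in> I" "y \<in> I"
  show "(\<lambda>t. L (f t)) absolutely_integrable_on {x..y}"
    using absolutely_integrable_linear[OF primitive_on_integrable(1)[OF assms(2) xy] assms(1)]
    by (simp add: o_def)
  show "L (F y) - L (F x) = integral {x..y} (\<lambda>t. L (f t))" if "x \<le> y"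
    using integral_linear[OF primitive_on_integrable(2)[OF assms(2) xy] assms(1)]
      primitive_onD[OF assms(2) xy that] by (simp add: o_def flip: diff)
qed

lemma primitive_on_add:
  assumes "primitive_on I F f" "primitive_on I G g"
  shows "primitive_on I (\<lambda>t. F t + G t) (\<lambda>t. f t + g t)"
  unfolding primitive_on_def integrable_within_def
proof (intro conjI ballI impI)
  fix x y assume xy: "x \<in> I" "y \<in> I"
  show "(\<lambda>t. f t + g t) absolutely_integrable_on {x..y}"
    by (intro set_integral_add primitive_on_integrable[OF assms(1)] primitive_on_integrable[OF assms(2)] xy)
  show "F y + G y - (F x + G x) = integral {x..y} (\<lambda>t. f t + g t)" if "x \<le> y"
    using primitive_onD[OF assms(1) xy that] primitive_onD[OF assms(2) xy that]
      Henstock_Kurzweil_Integration.integral_add[OF primitive_on_integrable(2)[OF assms(1) xy] primitive_on_integrable(2)[OF assms(2) xy]]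
    by (simp add: algebra_simps)
qed

lemma primitive_on_diff:
  assumes "primitive_on I F f" "primitive_on I G g"
  shows "primitive_on I (\<lambda>t. F t - G t) (\<lambda>t. f t - g t)"
  using primitive_on_add[OF assms(1) primitive_on_linear[OF bounded_linear_minus[OF bounded_linear_ident] assms(2)]]
  by simp

lemma primitive_on_Pair:
  fixes F :: "real \<Rightarrow> 'a::euclidean_space" and G :: "real \<Rightarrow> 'b::euclidean_space"
  assumes "primitive_on I F f" "primitive_on I G g"
  shows "primitive_on I (\<lambda>t. (F t, G t)) (\<lambda>t. (f t, g t))"
proof -
  have "bounded_linear (\<lambda>x::'a. (x, 0::'b))" "bounded_linear (\<lambda>x::'b. (0::'a, x))"
    by (auto intro!: bounded_linear_Pair bounded_linear_ident bounded_linear_zero)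
  from primitive_on_add[OF primitive_on_linear[OF this(1) assms(1)] primitive_on_linear[OF this(2) assms(2)]]
  show ?thesis by simp
qed

lemma primitive_on_norm_le:
  fixes F :: "real \<Rightarrow> 'a::euclidean_space"
  assumes "primitive_on I F f" "primitive_on I \<kappa> k" "x \<in> I" "y \<in> I" "x \<le> y"
    and "\<And>t. x \<le> t \<Longrightarrow> t \<le> y \<Longrightarrow> norm (f t) \<le> k t"
  shows "norm (F y - F x) \<le> \<kappa> y - \<kappa> x"
  unfolding primitive_onD[OF assms(1,3,4,5)] primitive_onD[OF assms(2,3,4,5)]
  by (rule integral_norm_bound_integral) (use assms primitive_on_integrable in auto)

lemma primitive_on_mono:
  fixes F :: "real \<Rightarrow> real"
  assumes "primitive_on I F f" "x \<in> I" "y \<in> I" "x \<le> y"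
    and "\<And>t. x \<le> t \<Longrightarrow> t \<le> y \<Longrightarrow> 0 \<le> f t"
  shows "F x \<le> F y"
proof -
  have "0 \<le> F y - F x"
    unfolding primitive_onD[OF assms(1,2,3,4)]
    by (rule integral_nonneg) (use assms primitive_on_integrable in auto)
  then show ?thesis by simp
qed

lemma integrable_within_norm: "integrable_within I f \<Longrightarrow> integrable_within I (\<lambda>t. norm (f t))"
  by (auto simp: integrable_within_def intro: absolutely_integrable_norm[unfolded o_def])

lemma integrable_within_add:
  "integrable_within I f \<Longrightarrow> integrable_within I g \<Longrightarrow> integrable_within I (\<lambda>t. f t + g t)"
  by (auto simp: integrable_within_def intro: set_integral_add)

lemma integrable_within_diff:
  "integrable_within I f \<Longrightarrow> integrable_within I g \<Longrightarrow> integrable_within I (\<lambda>t. f t - g t)"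
  by (auto simp: integrable_within_def intro: set_integral_diff)

lemma integrable_within_linear:
  fixes L :: "'a::euclidean_space \<Rightarrow> 'b::euclidean_space"
  shows "bounded_linear L \<Longrightarrow> integrable_within I f \<Longrightarrow> integrable_within I (\<lambda>t. L (f t))"
  by (auto simp: integrable_within_def intro: absolutely_integrable_linear[unfolded o_def])

lemma integrable_within_Pair:
  fixes f :: "real \<Rightarrow> 'a::euclidean_space" and g :: "real \<Rightarrow> 'b::euclidean_space"
  assumes "integrable_within I f" "integrable_within I g"
  shows "integrable_within I (\<lambda>t. (f t, g t))"
proof -
  have "bounded_linear (\<lambda>x::'a. (x, 0::'b))" "bounded_linear (\<lambda>x::'b. (0::'a, x))"
    by (auto intro!: bounded_linear_Pair bounded_linear_ident bounded_linear_zero)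
  from integrable_within_add[OF integrable_within_linear[OF this(1) assms(1)]
      integrable_within_linear[OF this(2) assms(2)]]
  show ?thesis by simp
qed

lemma integrable_within_bilinear:
  fixes h :: "'a::euclidean_space \<Rightarrow> 'b::euclidean_space \<Rightarrow> 'c::euclidean_space"
  assumes "bounded_bilinear h" "is_interval I" "continuous_on I f" "integrable_within I g"
  shows "integrable_within I (\<lambda>t. h (f t) (g t))"
  unfolding integrable_within_def
proof (intro ballI)
  fix x y assume xy: "x \<in> I" "y \<in> I"
  have c: "continuous_on {x..y} f"
    using continuous_on_subset[OF assms(3) Icc_subset_interval[OF assms(2) xy]] .
  show "(\<lambda>t. h (f t) (g t)) absolutely_integrable_on {x..y}"
  proof (rule absolutely_integrable_bounded_measurable_product[where h = h])
    show "bilinear h" using assms(1) by (simp add: bilinear_conv_bounded_bilinear)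
    show "f \<in> borel_measurable (lebesgue_on {x..y})"
      by (rule continuous_imp_measurable_on_sets_lebesgue[OF c]) auto
    show "bounded (f ` {x..y})"
      using c compact_continuous_image compact_imp_bounded by blast
    show "g absolutely_integrable_on {x..y}"
      using assms(4) xy by (auto simp: integrable_within_def)
  qed auto
qed

text \<open>
  A bound by \<open>\<epsilon>\<close> times the increment of \<open>\<kappa>\<close> is additive over adjacent intervals, so if it holds on
  short intervals, bisection gives it on \<open>{x..y}\<close>; then \<open>\<epsilon>\<close> tends to \<open>0\<close>.
\<close>

lemma increment_zero_by_small_oscillation:
  fixes H :: "real \<Rightarrow> 'a::real_normed_vector" and \<kappa> :: "real \<Rightarrow> real"
  assumes "x \<le> y"
    and "\<And>\<epsilon>. \<epsilon> > 0 \<Longrightarrow> \<exists>\<delta>>0. \<forall>s t. x \<le> s \<and> s \<le> t \<and> t \<le> y \<and> t - s < \<delta> \<longrightarrow>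
            norm (H t - H s) \<le> \<epsilon> * (\<kappa> t - \<kappa> s)"
  shows "H y = H x"
proof -
  have "norm (H y - H x) \<le> \<epsilon> * (\<kappa> y - \<kappa> x)" if "\<epsilon> > 0" for \<epsilon>
  proof -
    obtain \<delta> where \<delta>: "\<delta> > 0" "\<And>s t. x \<le> s \<Longrightarrow> s \<le> t \<Longrightarrow> t \<le> y \<Longrightarrow> t - s < \<delta> \<Longrightarrow>
        norm (H t - H s) \<le> \<epsilon> * (\<kappa> t - \<kappa> s)" using assms(2)[OF \<open>\<epsilon> > 0\<close>] by blast
    define P where "P = (\<lambda>a b. x \<le> a \<and> b \<le> y \<longrightarrow> norm (H b - H a) \<le> \<epsilon> * (\<kappa> b - \<kappa> a))"
    have "P x y"
      using assms(1)
    proof (induction rule: Bolzano)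
      case (trans a b c)
      show ?case
        unfolding P_def
      proof
        assume "x \<le> a \<and> c \<le> y"
        then have "norm (H b - H a) \<le> \<epsilon> * (\<kappa> b - \<kappa> a)" "norm (H c - H b) \<le> \<epsilon> * (\<kappa> c - \<kappa> b)"
          using trans by (auto simp: P_def)
        moreover have "norm (H c - H a) \<le> norm (H b - H a) + norm (H c - H b)"
          using norm_triangle_ineq[of "H b - H a" "H c - H b"] by simp
        ultimately show "norm (H c - H a) \<le> \<epsilon> * (\<kappa> c - \<kappa> a)"
          by (simp add: algebra_simps)
      qed
    next
      case (local z)
      show ?case using \<delta> by (intro exI[of _ \<delta>]) (auto simp: P_def)
    qed
    then show ?thesis by (simp add: P_def)
  qed
  note le = this
  have "norm (H y - H x) \<le> 0"
  proof (rule field_le_epsilon)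
    fix e :: real assume "e > 0"
    have "norm (H y - H x) \<le> e / (\<bar>\<kappa> y - \<kappa> x\<bar> + 1) * (\<kappa> y - \<kappa> x)"
      using \<open>e > 0\<close> by (intro le) (simp add: add_nonneg_pos)
    also have "\<dots> \<le> e / (\<bar>\<kappa> y - \<kappa> x\<bar> + 1) * (\<bar>\<kappa> y - \<kappa> x\<bar> + 1)"
      using \<open>e > 0\<close> by (intro mult_left_mono) auto
    also have "\<dots> = e" by (simp add: add_nonneg_pos)
    finally show "norm (H y - H x) \<le> 0 + e" by simp
  qed
  then show ?thesis by simp
qed

text \<open>
  The product rule for absolutely continuous functions. On a short interval \<open>{s..t}\<close> the increment of
  the product is the integral of \<open>h (F s) g + h f (G t)\<close>, which differs from the integral of
  \<open>h F g + h f G\<close> by at most a constant times the oscillation of \<open>F\<close> and \<open>G\<close> times the integral of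
  \<open>norm f + norm g\<close>. By uniform continuity this is the situation of
  \<open>increment_zero_by_small_oscillation\<close>.
\<close>

lemma primitive_on_bilinear:
  fixes h :: "'a::euclidean_space \<Rightarrow> 'b::euclidean_space \<Rightarrow> 'c::euclidean_space"
  assumes h: "bounded_bilinear h" and I: "open I" "is_interval I"
    and F: "primitive_on I F f" and G: "primitive_on I G g"
  shows "primitive_on I (\<lambda>t. h (F t) (G t)) (\<lambda>t. h (F t) (g t) + h (f t) (G t))"
proof -
  interpret bounded_bilinear h by fact
  obtain B where B: "B > 0" "\<And>a b. norm (h a b) \<le> norm a * norm b * B"
    using pos_bounded by blast
  have cF: "continuous_on I F" and cG: "continuous_on I G"
    using primitive_on_continuous[OF I] F G by auto
  have int: "integrable_within I (\<lambda>t. h (F t) (g t) + h (f t) (G t))"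
    by (intro integrable_within_add integrable_within_bilinear[OF h I(2) cF]
        integrable_within_bilinear[OF bounded_bilinear.flip[OF h] I(2) cG] primitive_on_integrable_within[OF F]
        primitive_on_integrable_within[OF G])
  show ?thesis
    unfolding primitive_on_def
  proof (intro conjI ballI impI int)
    fix x y assume xy: "x \<in> I" "y \<in> I" "x \<le> y"
    have sub: "{x..y} \<subseteq> I" using Icc_subset_interval[OF I(2) xy(1,2)] .
    obtain P where P: "primitive_on I P (\<lambda>t. h (F t) (g t) + h (f t) (G t))"
      using primitive_on_exists[OF I(2) xy(1) int] by metis
    obtain \<kappa> where \<kappa>: "primitive_on I \<kappa> (\<lambda>t. norm (f t) + norm (g t))"
      using primitive_on_exists[OF I(2) xy(1) integrable_within_add[OF integrable_within_norm integrable_within_norm,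
            OF primitive_on_integrable_within[OF F] primitive_on_integrable_within[OF G]]] by metis
    define H where "H = (\<lambda>t. h (F t) (G t) - P t)"
    have "H y = H x"
    proof (rule increment_zero_by_small_oscillation[OF xy(3), where \<kappa> = \<kappa>])
      fix \<epsilon> :: real assume "\<epsilon> > 0"
      then have e: "\<epsilon> / B > 0" using B by simp
      have "uniformly_continuous_on {x..y} F" "uniformly_continuous_on {x..y} G"
        using compact_uniformly_continuous continuous_on_subset[OF _ sub] cF cG by blast+
      from uniformly_continuous_onE[OF this(1) e] uniformly_continuous_onE[OF this(2) e]
      obtain d1 d2 where d1: "d1 > 0" "\<And>s t. s \<in> {x..y} \<Longrightarrow> t \<in> {x..y} \<Longrightarrow> dist t s < d1 \<Longrightarrow> dist (F t) (F s) < \<epsilon> / B"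
        and d2: "d2 > 0" "\<And>s t. s \<in> {x..y} \<Longrightarrow> t \<in> {x..y} \<Longrightarrow> dist t s < d2 \<Longrightarrow> dist (G t) (G s) < \<epsilon> / B"
        by metis
      have "norm (H t - H s) \<le> \<epsilon> * (\<kappa> t - \<kappa> s)"
        if st: "x \<le> s" "s \<le> t" "t \<le> y" "t - s < min d1 d2" for s t
      proof -
        have stI: "s \<in> I" "t \<in> I" using sub st by auto
        have hF: "bounded_linear (h a)" "bounded_linear (\<lambda>z. h z b)" for a b
          by (rule bounded_linear_right bounded_linear_left)+
        (* Freezing F at s and G at t makes the bilinear expression linear in the remaining factor,
           and its increments over s, t add up exactly to the increment of the product. *)
        have Q: "primitive_on I (\<lambda>r. h (F s) (G r) + h (F r) (G t) - P r)
            (\<lambda>r. (h (F s) (g r) + h (f r) (G t)) - (h (F r) (g r) + h (f r) (G r)))"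
          by (intro primitive_on_diff P primitive_on_add primitive_on_linear[OF hF(1) G]
              primitive_on_linear[OF hF(2) F])
        have \<kappa>': "primitive_on I (\<lambda>r. \<epsilon> * \<kappa> r) (\<lambda>r. \<epsilon> * (norm (f r) + norm (g r)))"
          by (rule primitive_on_linear[OF bounded_linear_mult_right \<kappa>])
        have "norm ((h (F s) (G t) + h (F t) (G t) - P t) - (h (F s) (G s) + h (F s) (G t) - P s))
            \<le> \<epsilon> * \<kappa> t - \<epsilon> * \<kappa> s"
        proof (rule primitive_on_norm_le[OF Q \<kappa>' stI st(2)])
          fix r assume r: "s \<le> r" "r \<le> t"
          have "norm (F s - F r) \<le> \<epsilon> / B" "norm (G t - G r) \<le> \<epsilon> / B"
            using d1(2)[of r s] d2(2)[of r t] r st by (auto simp: dist_norm)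
          then have "norm (F s - F r) * norm (g r) * B \<le> \<epsilon> / B * norm (g r) * B"
            "norm (f r) * norm (G t - G r) * B \<le> norm (f r) * (\<epsilon> / B) * B"
            using B(1) by (intro mult_right_mono mult_left_mono; simp)+
          then have "norm (h (F s - F r) (g r)) \<le> \<epsilon> / B * norm (g r) * B"
            "norm (h (f r) (G t - G r)) \<le> norm (f r) * (\<epsilon> / B) * B"
            using B(2) order_trans by blast+
          then have "norm (h (F s - F r) (g r)) + norm (h (f r) (G t - G r)) \<le> \<epsilon> * (norm (f r) + norm (g r))"
            using B(1) by (simp add: algebra_simps)
          moreover have "(h (F s) (g r) + h (f r) (G t)) - (h (F r) (g r) + h (f r) (G r))
              = h (F s - F r) (g r) + h (f r) (G t - G r)"
            by (simp add: diff_left diff_right)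
          ultimately show "norm ((h (F s) (g r) + h (f r) (G t)) - (h (F r) (g r) + h (f r) (G r)))
              \<le> \<epsilon> * (norm (f r) + norm (g r))"
            using norm_triangle_ineq order_trans by metis
        qed
        then show ?thesis by (simp add: H_def algebra_simps)
      qed
      then show "\<exists>\<delta>>0. \<forall>s t. x \<le> s \<and> s \<le> t \<and> t \<le> y \<and> t - s < \<delta> \<longrightarrow> norm (H t - H s) \<le> \<epsilon> * (\<kappa> t - \<kappa> s)"
        using d1(1) d2(1) by (intro exI[of _ "min d1 d2"]) auto
    qed
    then show "h (F y) (G y) - h (F x) (G x) = integral {x..y} (\<lambda>t. h (F t) (g t) + h (f t) (G t))"
      using primitive_onD[OF P xy] by (simp add: H_def algebra_simps)
  qed
qed

lemma primitive_on_power: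
  fixes F :: "real \<Rightarrow> real"
  assumes "open I" "is_interval I" "primitive_on I F f"
  shows "primitive_on I (\<lambda>t. F t ^ Suc n) (\<lambda>t. real (Suc n) * F t ^ n * f t)"
proof (induction n)
  case 0
  then show ?case using assms by simp
next
  case (Suc n)
  from primitive_on_bilinear[OF bounded_bilinear_mult assms(1,2,3) Suc]
  show ?case by (simp add: algebra_simps)
qed

section \<open>Differentiability almost everywhere and absolute continuity\<close>

text \<open>
  Lebesgue's differentiation theorem on the line. One-sided averages from the right converge almost
  everywhere by \<open>integrable_ccontinuous_explicit\<close>; the averages from the left are those from the
  right for the reflected function.
\<close>

lemma primitive_on_interval_has_derivative_ae:
  fixes F :: "real \<Rightarrow> 'a::euclidean_space"
  assumes "primitive_on {p..q} F f"
  shows "\<exists>N. negligible N \<and> (\<forall>x\<in>{p<..<q} - N. (F has_vector_derivative f x) (at x))"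
proof (cases "p < q")
  case False
  then show ?thesis by (intro exI[of _ "{}"]) auto
next
  case True
  define g where "g = (\<lambda>t. if t \<in> {p..q} then f t else 0)"
  have fint: "f integrable_on {x..y}" if "x \<in> {p..q}" "y \<in> {p..q}" for x y
    using primitive_on_integrable(2)[OF assms that] .
  have "f integrable_on {p..q}" using fint True by simp
  then have gU: "g integrable_on UNIV"
    unfolding g_def by (subst integrable_restrict_UNIV)
  then have g: "g integrable_on {a..b}" for a b
    using integrable_on_subinterval by blast
  then have "(\<lambda>t. g (- t)) integrable_on {a..b}" for a b
    using Henstock_Kurzweil_Integration.integrable_reflect_real[of g "- a" "- b"] by simp
  note g' = this
  have diff: "\<exists>N. negligible N \<and> (\<forall>x e. x \<notin> N \<longrightarrow> 0 < e \<longrightarrow>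
      (\<exists>d>0. \<forall>h. 0 < h \<and> h < d \<longrightarrow> norm (integral {x..x + h} G /\<^sub>R h - G x) < e))"
    if "\<And>a b. G integrable_on {a..b}" for G :: "real \<Rightarrow> 'a"
  proof -
    have "G integrable_on cbox a b" for a b using that by (simp add: cbox_interval)
    from integrable_ccontinuous_explicit[OF this] show ?thesis
      by (simp add: cbox_interval) metis
  qed
  obtain N1 where N1: "negligible N1" "\<And>x e. x \<notin> N1 \<Longrightarrow> 0 < e \<Longrightarrow>
      \<exists>d>0. \<forall>h. 0 < h \<and> h < d \<longrightarrow> norm (integral {x..x + h} g /\<^sub>R h - g x) < e"
    using diff[of g] g by blast
  obtain N2 where N2: "negligible N2" "\<And>x e. x \<notin> N2 \<Longrightarrow> 0 < e \<Longrightarrow>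
      \<exists>d>0. \<forall>h. 0 < h \<and> h < d \<longrightarrow> norm (integral {x..x + h} (\<lambda>t. g (- t)) /\<^sub>R h - g (- x)) < e"
    using diff[of "\<lambda>t. g (- t)"] g' by blast
  have "negligible (uminus ` N2)"
    by (rule negligible_differentiable_image_negligible[OF order_refl N2(1)])
      (intro differentiable_on_minus differentiable_on_ident)
  then have "negligible (N1 \<union> uminus ` N2)" using N1(1) by simp
  moreover have "(F has_vector_derivative f x) (at x)" if x: "x \<in> {p<..<q} - (N1 \<union> uminus ` N2)" for x
    unfolding has_vector_derivative_def has_derivative_within_alt
  proof (intro conjI allI impI bounded_linear_scaleR_left)
    fix e :: real assume e: "e > 0"
    have xN: "x \<notin> N1" "- x \<notin> N2" using x by force+
    obtain d1 where d1: "d1 > 0" "\<And>h. 0 < h \<Longrightarrow> h < d1 \<Longrightarrow> norm (integral {x..x + h} g /\<^sub>R h - g x) < e"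
      using N1(2)[OF xN(1) e] by blast
    obtain d2 where d2: "d2 > 0" "\<And>h. 0 < h \<Longrightarrow> h < d2 \<Longrightarrow>
        norm (integral {- x..- x + h} (\<lambda>t. g (- t)) /\<^sub>R h - g x) < e"
      using N2(2)[OF xN(2) e] by auto
    define d where "d = Min {d1, d2, x - p, q - x}"
    have d: "d > 0" "d \<le> d1" "d \<le> d2" "d \<le> x - p" "d \<le> q - x"
      using d1(1) d2(1) x by (auto simp: d_def)
    have rest: "integral {a..b} f = integral {a..b} g" if "p \<le> a" "b \<le> q" for a b
      by (rule integral_cong) (use that in \<open>auto simp: g_def\<close>)
    have gx: "g x = f x" using x by (auto simp: g_def)
    have scale: "norm (J - h *\<^sub>R f x) \<le> e * h" if "h > 0" "norm (J /\<^sub>R h - f x) < e" for h and J :: 'a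
    proof -
      have "J - h *\<^sub>R f x = h *\<^sub>R (J /\<^sub>R h - f x)" using that(1) by (simp add: scaleR_diff_right)
      then have "norm (J - h *\<^sub>R f x) = h * norm (J /\<^sub>R h - f x)" using that(1) by simp
      then show ?thesis using that by (simp add: mult.commute less_imp_le)
    qed
    have "norm (F y - F x - (y - x) *\<^sub>R f x) \<le> e * norm (y - x)" if y: "norm (y - x) < d" for y
    proof (cases y x rule: linorder_cases)
      case greater
      have "F y - F x = integral {x..x + (y - x)} g"
        using primitive_onD[OF assms, of x y] y greater x d by (auto simp: rest)
      then show ?thesis
        using scale[of "y - x" "F y - F x"] d1(2)[of "y - x"] greater y d by (simp add: gx)
    next
      case less
      have "F x - F y = integral {y..x} g"
        using primitive_onD[OF assms, of y x] y less x d by (auto simp: rest)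
      also have "\<dots> = integral {- x..- x + (x - y)} (\<lambda>t. g (- t))"
        using Henstock_Kurzweil_Integration.integral_reflect_real[of x y g] by simp
      finally have "norm ((F x - F y) - (x - y) *\<^sub>R f x) \<le> e * (x - y)"
        using scale[of "x - y" "F x - F y"] d2(2)[of "x - y"] less y d by (simp add: gx)
      moreover have "F y - F x - (y - x) *\<^sub>R f x = - ((F x - F y) - (x - y) *\<^sub>R f x)"
        by (simp add: algebra_simps)
      then have "norm (F y - F x - (y - x) *\<^sub>R f x) = norm ((F x - F y) - (x - y) *\<^sub>R f x)"
        by (metis norm_minus_cancel)
      ultimately show ?thesis using less by simp
    qed auto
    then show "\<exists>d>0. \<forall>y\<in>UNIV. norm (y - x) < d \<longrightarrow> norm (F y - F x - (y - x) *\<^sub>R f x) \<le> e * norm (y - x)"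
      using d(1) by blast
  qed
  ultimately show ?thesis by blast
qed

text \<open>
  An open interval is covered by countably many compact subintervals with rational endpoints.
\<close>

lemma primitive_on_has_derivative_ae:
  fixes F :: "real \<Rightarrow> 'a::euclidean_space"
  assumes I: "open I" "is_interval I" and F: "primitive_on I F f"
  shows "AE x in lebesgue. x \<in> I \<longrightarrow> (F has_vector_derivative f x) (at x)"
proof -
  define R where "R = {(p, q). p \<in> \<rat> \<and> q \<in> \<rat> \<and> {p..q} \<subseteq> I}"
  have "\<exists>N. negligible N \<and> (\<forall>x\<in>{fst r<..<snd r} - N. (F has_vector_derivative f x) (at x))" if "r \<in> R" for r
    using primitive_on_interval_has_derivative_ae[OF primitive_on_subset[OF F]] that
    by (auto simp: R_def)
  then obtain N where N: "\<And>r. r \<in> R \<Longrightarrow> negligible (N r)"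
    "\<And>r x. r \<in> R \<Longrightarrow> x \<in> {fst r<..<snd r} - N r \<Longrightarrow> (F has_vector_derivative f x) (at x)"
    by metis
  have "countable R"
    by (rule countable_subset[of _ "\<rat> \<times> \<rat>"]) (auto simp: R_def countable_rat)
  then have "negligible (\<Union> (N ` R))"
    using N(1) by (intro negligible_countable_Union) auto
  then have "AE x in lebesgue. x \<notin> \<Union> (N ` R)"
    by (intro AE_not_in) (simp add: negligible_iff_null_sets)
  then show ?thesis
  proof (rule eventually_mono, intro impI)
    fix x assume x: "x \<notin> \<Union> (N ` R)" "x \<in> I"
    obtain d where d: "d > 0" "{x - d..x + d} \<subseteq> I"
      using open_interval_neighbourhood[OF I x(2)] .
    obtain p q where "p \<in> \<rat>" "x - d < p" "p < x" "q \<in> \<rat>" "x < q" "q < x + d"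
      using Rats_dense_in_real[of "x - d" x] Rats_dense_in_real[of x "x + d"] d(1) by auto
    then have "(p, q) \<in> R" using d(2) by (auto simp: R_def subset_iff)
    then show "(F has_vector_derivative f x) (at x)"
      using N(2)[of "(p, q)" x] x(1) \<open>p < x\<close> \<open>x < q\<close> by auto
  qed
qed

text \<open>
  The part of an integrable function above the height \<open>n\<close> tends to \<open>0\<close> in the mean, by dominated
  convergence.
\<close>

lemma integral_truncation_small:
  fixes k :: "real \<Rightarrow> real"
  assumes "k absolutely_integrable_on {c..d}" "\<And>t. 0 \<le> k t" "e > 0"
  obtains n where "(\<lambda>t. min (k t) (real n)) integrable_on {c..d}"
    "integral {c..d} (\<lambda>t. k t - min (k t) (real n)) < e"
proof -
  have m: "(\<lambda>t. min (k t) (real n)) absolutely_integrable_on {c..d}" for n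
    by (intro absolutely_integrable_min_1 assms) (simp add: absolutely_integrable_continuous_real)
  have k: "k integrable_on {c..d}" using assms(1) by (rule set_lebesgue_integral_eq_integral(1))
  have mi: "(\<lambda>t. min (k t) (real n)) integrable_on {c..d}" for n
    using m by (rule set_lebesgue_integral_eq_integral(1))
  have "(\<lambda>n. integral {c..d} (\<lambda>t. k t - min (k t) (real n))) \<longlonglongrightarrow> integral {c..d} (\<lambda>t. 0)"
  proof (rule dominated_convergence(2)[OF _ k])
    fix t
    show "(\<lambda>n. k t - min (k t) (real n)) \<longlonglongrightarrow> 0"
    proof (rule tendsto_eventually)
      obtain n0 where "k t \<le> real n0" using real_arch_simple by blast
      then show "\<forall>\<^sub>F n in sequentially. k t - min (k t) (real n) = 0"
        by (intro eventually_sequentiallyI[of n0]) auto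
    qed
  next
    fix n show "(\<lambda>t. k t - min (k t) (real n)) integrable_on {c..d}"
      by (intro integrable_diff k mi)
  qed (use assms(2) in \<open>auto simp: min_def\<close>)
  then have "\<forall>\<^sub>F n in sequentially. integral {c..d} (\<lambda>t. k t - min (k t) (real n)) < e"
    using assms(3) by (auto dest!: order_tendstoD(2))
  then obtain n where "integral {c..d} (\<lambda>t. k t - min (k t) (real n)) < e"
    by (auto simp: eventually_sequentially)
  with mi that show ?thesis by blast
qed

text \<open>
  Cut \<open>norm f\<close> at a height \<open>n\<close> for which the part above \<open>n\<close> has integral less than \<open>\<epsilon> / 2\<close>. The part
  below \<open>n\<close> contributes at most \<open>n\<close> times the total length of the subintervals.
\<close>

lemma primitive_on_abs_continuous:
  assumes F: "primitive_on I F f" and I: "is_interval I"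
  shows "locally_abs_continuous_on I F"
  unfolding locally_abs_continuous_on_def
proof (intro allI impI)
  fix c d :: real assume cd: "{c..d} \<subseteq> I"
  show "abs_continuous_on {c..d} F"
    unfolding abs_continuous_on_def
  proof (intro allI impI)
    fix \<epsilon> :: real assume e: "\<epsilon> > 0"
    let ?k = "\<lambda>t. norm (f t)"
    have kint: "?k absolutely_integrable_on {c..d}"
    proof (cases "c \<le> d")
      case True
      then show ?thesis
        using integrable_within_norm[OF primitive_on_integrable_within[OF F]] cd
        unfolding integrable_within_def by (meson atLeastAtMost_iff order_refl subsetD)
    qed auto
    obtain n where n: "(\<lambda>t. min (?k t) (real n)) integrable_on {c..d}"
      "integral {c..d} (\<lambda>t. ?k t - min (?k t) (real n)) < \<epsilon> / 2"
      using integral_truncation_small[OF kint, of "\<epsilon> / 2"] e by auto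
    let ?r = "\<lambda>t. ?k t - min (?k t) (real n)"
    have ki: "?k integrable_on {c..d}" using kint by (rule set_lebesgue_integral_eq_integral(1))
    have ri: "?r integrable_on {c..d}" by (intro integrable_diff ki n(1))
    show "\<exists>\<delta>>0. \<forall>D T. D division_of T \<and> T \<subseteq> {c..d} \<and> (\<Sum>K\<in>D. Sup K - Inf K) < \<delta> \<longrightarrow>
        (\<Sum>K\<in>D. norm (F (Sup K) - F (Inf K))) < \<epsilon>"
    proof (intro exI[of _ "\<epsilon> / (2 * (real n + 1))"] conjI allI impI)
      show "\<epsilon> / (2 * (real n + 1)) > 0" using e by simp
      fix D T assume D: "D division_of T \<and> T \<subseteq> {c..d} \<and> (\<Sum>K\<in>D. Sup K - Inf K) < \<epsilon> / (2 * (real n + 1))"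
      have rT: "?r integrable_on T"
        using integrable_on_subdivision[of D T ?r "{c..d}"] D ri by auto
      have le: "norm (F (Sup K) - F (Inf K)) \<le> integral K ?r + real n * (Sup K - Inf K)" if KD: "K \<in> D" for K
      proof -
        obtain x y where K: "K = {x..y}" "x \<le> y" "{x..y} \<subseteq> {c..d}"
        proof -
          have "K \<noteq> {}" "\<exists>x y. K = cbox x y" "K \<subseteq> {c..d}" using D KD division_ofD(2,3,4)[of D T K] by auto
          then show thesis using that by auto
        qed
        then have xy: "x \<in> I" "y \<in> I" using cd by auto
        have iK: "?k integrable_on {x..y}" "(\<lambda>t. min (?k t) (real n)) integrable_on {x..y}"
          "?r integrable_on {x..y}"
          using integrable_on_subinterval K(3) ki n(1) ri by blast+
        have "norm (F y - F x) \<le> integral {x..y} ?k"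
          unfolding primitive_onD[OF F xy K(2)]
          by (rule integral_norm_bound_integral) (use iK primitive_on_integrable[OF F xy] in auto)
        also have "\<dots> = integral {x..y} (\<lambda>t. ?r t + min (?k t) (real n))" by simp
        also have "\<dots> = integral {x..y} ?r + integral {x..y} (\<lambda>t. min (?k t) (real n))"
          by (rule Henstock_Kurzweil_Integration.integral_add[OF iK(3,2)])
        also have "integral {x..y} (\<lambda>t. min (?k t) (real n)) \<le> integral {x..y} (\<lambda>t. real n)"
          by (rule integral_le[OF iK(2)]) auto
        finally show ?thesis using K(1,2) by (simp add: mult.commute)
      qed
      have "(\<Sum>K\<in>D. norm (F (Sup K) - F (Inf K))) \<le> (\<Sum>K\<in>D. integral K ?r + real n * (Sup K - Inf K))"
        by (rule sum_mono[OF le])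
      also have "\<dots> = integral T ?r + real n * (\<Sum>K\<in>D. Sup K - Inf K)"
        using integral_combine_division_topdown[OF rT, of D] D by (simp add: sum.distrib sum_distrib_left)
      also have "integral T ?r \<le> integral {c..d} ?r"
        by (rule integral_subset_le) (use D rT ri in auto)
      also have "\<dots> < \<epsilon> / 2" by (fact n(2))
      also have "real n * (\<Sum>K\<in>D. Sup K - Inf K) \<le> real n * (\<epsilon> / (2 * (real n + 1)))"
        using D by (intro mult_left_mono) auto
      also have "real n * (\<epsilon> / (2 * (real n + 1))) \<le> \<epsilon> / 2"
        using e by (simp add: field_simps)
      finally show "(\<Sum>K\<in>D. norm (F (Sup K) - F (Inf K))) < \<epsilon>" by simp
    qed
  qed
qed

section \<open>Linear equations with locally integrable coefficients\<close>

text \<open>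
  The equation \<open>y' = K y\<close> in the sense of Caratheodory. Its size is measured by \<open>\<kappa>\<close>, the primitive of
  the dominating function \<open>k\<close> that vanishes at the initial point \<open>c\<close>; to the left of \<open>c\<close> it is
  negative. In place of measurability in \<open>t\<close>, the last assumption asks for what the Picard iteration
  uses: \<open>K\<close> maps continuous functions to locally integrable ones.
\<close>

locale linear_equation =
  fixes I :: "real set" and c :: real and K :: "real \<Rightarrow> 'a::euclidean_space \<Rightarrow> 'a"
    and k \<kappa> :: "real \<Rightarrow> real"
  assumes open_I: "open I" and interval_I: "is_interval I" and c: "c \<in> I"
    and linear_K: "\<And>t. t \<in> I \<Longrightarrow> linear (K t)"
    and norm_K_le: "\<And>t y. t \<in> I \<Longrightarrow> norm (K t y) \<le> k t * norm y"
    and k_nonneg: "\<And>t. t \<in> I \<Longrightarrow> 0 \<le> k t"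
    and primitive_\<kappa>: "primitive_on I \<kappa> k" and \<kappa>_c: "\<kappa> c = 0"
    and integrable_K: "\<And>y. continuous_on I y \<Longrightarrow> integrable_within I (\<lambda>t. K t (y t))"
begin

lemma \<kappa>_mono: "x \<in> I \<Longrightarrow> y \<in> I \<Longrightarrow> x \<le> y \<Longrightarrow> \<kappa> x \<le> \<kappa> y"
  using Icc_subset_interval[OF interval_I, of x y]
  by (intro primitive_on_mono[OF primitive_\<kappa>] k_nonneg) (auto simp: subset_iff)

lemma \<kappa>_bounded: 
  assumes "x \<in> I" "y \<in> I" "t \<in> {x..y}" 
  shows "\<bar>\<kappa> t\<bar> \<le> max \<bar>\<kappa> x\<bar> \<bar>\<kappa> y\<bar>"
proof -
  have "t \<in> I" using Icc_subset_interval[OF interval_I, of x y] assms by auto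
  then have "\<kappa> x \<le> \<kappa> t" "\<kappa> t \<le> \<kappa> y" using assms \<kappa>_mono by auto
  then show ?thesis by linarith
qed

text \<open>
  Each Picard step gains a factor \<open>\<bar>\<kappa>\<bar> / n\<close>, because \<open>\<kappa> ^ n * k\<close> has the primitive
  \<open>\<kappa> ^ Suc n / Suc n\<close>. Applied to the Picard iterates this yields convergence; applied to the constant
  sequence \<open>F n = y\<close> of a solution that vanishes at \<open>c\<close> it yields uniqueness.
\<close>

lemma iterate_norm_le:
  assumes J: "J \<subseteq> I" "is_interval J" "c \<in> J"
    and prim: "\<And>n. primitive_on J (F (Suc n)) (\<lambda>t. K t (F n t))"
    and init: "\<And>n. F (Suc n) c = 0"
    and start: "\<And>t. t \<in> J \<Longrightarrow> norm (F 0 t) \<le> M"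
    and x: "x \<in> J"
  shows "norm (F n x) \<le> M * \<bar>\<kappa> x\<bar> ^ n / fact n"
  using x
proof (induction n arbitrary: x)
  case 0
  then show ?case using start by simp
next
  case (Suc n)
  (* The sign \<sigma> serves both sides of c at once: \<sigma> * \<kappa> is nonnegative to the right of c for
     \<sigma> = 1 and to the left of c for \<sigma> = - 1. *)
  have pow: "primitive_on J (\<lambda>t. M / fact (Suc n) * (\<sigma> * (\<sigma> * \<kappa> t) ^ Suc n))
      (\<lambda>t. M / fact n * ((\<sigma> * \<kappa> t) ^ n * k t))" if \<sigma>: "\<sigma> = 1 \<or> \<sigma> = - 1" for \<sigma> :: real
  proof -
    have s: "\<sigma> * \<sigma> = 1" using \<sigma> by auto
    have "primitive_on J (\<lambda>t. (\<sigma> * \<kappa> t) ^ Suc n) (\<lambda>t. real (Suc n) * (\<sigma> * \<kappa> t) ^ n * (\<sigma> * k t))"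
      using primitive_on_subset[OF primitive_on_power[OF open_I interval_I
            primitive_on_linear[OF bounded_linear_mult_right primitive_\<kappa>]] J(1)] .
    from primitive_on_linear[OF bounded_linear_mult_right this, of "M / fact (Suc n) * \<sigma>"]
    show ?thesis
    proof (rule primitive_on_cong[OF J(2), rotated 2])
      fix t
      have "M / fact (Suc n) * \<sigma> * (real (Suc n) * (\<sigma> * \<kappa> t) ^ n * (\<sigma> * k t))
          = (\<sigma> * \<sigma>) * (M * (real (Suc n) / fact (Suc n))) * ((\<sigma> * \<kappa> t) ^ n * k t)"
        by (simp only: ac_simps times_divide_eq_right times_divide_eq_left)
      also have "real (Suc n) / fact (Suc n) = (1 / fact n :: real)"
        by (simp add: field_simps del: of_nat_Suc)
      finally show "M / fact (Suc n) * \<sigma> * (real (Suc n) * (\<sigma> * \<kappa> t) ^ n * (\<sigma> * k t))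
          = M / fact n * ((\<sigma> * \<kappa> t) ^ n * k t)" by (simp add: s)
    qed (simp add: algebra_simps)
  qed
  have bound: "norm (K t (F n t)) \<le> M / fact n * (\<bar>\<kappa> t\<bar> ^ n * k t)" if "t \<in> J" for t
  proof -
    have "norm (K t (F n t)) \<le> k t * norm (F n t)" using norm_K_le that J(1) by auto
    also have "\<dots> \<le> k t * (M * \<bar>\<kappa> t\<bar> ^ n / fact n)"
      using Suc.IH[OF that] k_nonneg that J(1) by (intro mult_left_mono) auto
    finally show ?thesis by (simp add: algebra_simps)
  qed
  show ?case
  proof (cases "c \<le> x")
    case True
    have "norm (F (Suc n) x - F (Suc n) c)
        \<le> M / fact (Suc n) * (1 * (1 * \<kappa> x) ^ Suc n) - M / fact (Suc n) * (1 * (1 * \<kappa> c) ^ Suc n)"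
    proof (rule primitive_on_norm_le[OF prim pow J(3) Suc.prems True])
      fix t assume t: "c \<le> t" "t \<le> x"
      then have tJ: "t \<in> J" using Icc_subset_interval[OF J(2,3) Suc.prems] by auto
      then have "0 \<le> \<kappa> t" using \<kappa>_mono[of c t] t J \<kappa>_c by auto
      then show "norm (K t (F n t)) \<le> M / fact n * ((1 * \<kappa> t) ^ n * k t)"
        using bound[OF tJ] by simp
    qed simp
    moreover have "0 \<le> \<kappa> x" using \<kappa>_mono[of c x] True J Suc.prems \<kappa>_c by auto
    ultimately show ?thesis by (simp add: init \<kappa>_c)
  next
    case False
    have "norm (F (Suc n) c - F (Suc n) x)
        \<le> M / fact (Suc n) * (- 1 * (- 1 * \<kappa> c) ^ Suc n) - M / fact (Suc n) * (- 1 * (- 1 * \<kappa> x) ^ Suc n)"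
    proof (rule primitive_on_norm_le[OF prim pow Suc.prems J(3)])
      fix t assume t: "x \<le> t" "t \<le> c"
      then have tJ: "t \<in> J" using Icc_subset_interval[OF J(2) Suc.prems J(3)] by auto
      then have "\<kappa> t \<le> 0" using \<kappa>_mono[of t c] t J \<kappa>_c by auto
      then show "norm (K t (F n t)) \<le> M / fact n * ((- 1 * \<kappa> t) ^ n * k t)"
        using bound[OF tJ] by (simp add: abs_of_nonpos)
    qed (use False in auto)
    moreover have "\<kappa> x \<le> 0" using \<kappa>_mono[of x c] False J Suc.prems \<kappa>_c by auto
    ultimately show ?thesis by (simp add: init \<kappa>_c abs_of_nonpos)
  qed
qed

lemma solution_zero:
  assumes y: "primitive_on I y (\<lambda>t. K t (y t))" and y0: "y c = 0" and x: "x \<in> I"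
  shows "y x = 0"
proof -
  define J where "J = {min c x..max c x}"
  have J: "J \<subseteq> I" "is_interval J" "c \<in> J" "x \<in> J"
    using Icc_subset_interval[OF interval_I, of "min c x" "max c x"] c x
    by (auto simp: J_def is_interval_cc min_def max_def)
  have "continuous_on J y"
    using continuous_on_subset[OF primitive_on_continuous[OF open_I interval_I y] J(1)] .
  then have "bounded (y ` J)"
    unfolding J_def by (intro compact_imp_bounded compact_continuous_image) auto
  then obtain M where M: "\<And>t. t \<in> J \<Longrightarrow> norm (y t) \<le> M"
    by (auto simp: bounded_iff)
  have "norm (y x) \<le> M * (\<bar>\<kappa> x\<bar> ^ n / fact n)" for n
    using iterate_norm_le[OF J(1,2,3) primitive_on_subset[OF y J(1)] y0 M J(4), of n] by simp
  moreover have "(\<lambda>n. M * (\<bar>\<kappa> x\<bar> ^ n / fact n)) \<longlonglongrightarrow> M * 0"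
    using summable_LIMSEQ_zero[OF summable_exp_generic[of "\<bar>\<kappa> x\<bar>"]]
    by (intro tendsto_mult_left) (simp add: field_simps)
  ultimately have "norm (y x) \<le> M * 0"
    by (intro tendsto_lowerbound[of _ _ sequentially]) auto
  then show ?thesis by simp
qed

text \<open>
  The solution is the sum of the Picard iterates \<open>F n\<close>. They are dominated by the terms of an
  exponential series in \<open>\<bar>\<kappa>\<bar>\<close>, which gives locally uniform convergence, an integrable majorant for
  passing to the limit under the integral, and the exponential bound.
\<close>

lemma solution_exists:
  obtains y where "primitive_on I y (\<lambda>t. K t (y t))" "y c = y0"
    "\<And>x. x \<in> I \<Longrightarrow> norm (y x) \<le> norm y0 * exp \<bar>\<kappa> x\<bar>"
proof -
  have "\<exists>P. continuous_on I f \<longrightarrow> primitive_on I P (\<lambda>t. K t (f t)) \<and> P c = 0" for f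
    using primitive_on_exists[OF interval_I c integrable_K, of f] by metis
  then obtain P where P: "\<And>f. continuous_on I f \<Longrightarrow> primitive_on I (P f) (\<lambda>t. K t (f t)) \<and> P f c = 0"
    by metis
  define F where "F n = (P ^^ n) (\<lambda>_. y0)" for n
  have F_Suc: "F (Suc n) = P (F n)" for n by (simp add: F_def)
  have F_cont: "continuous_on I (F n)" for n
  proof (induction n)
    case 0
    then show ?case by (simp add: F_def)
  next
    case (Suc n)
    then show ?case
      using primitive_on_continuous[OF open_I interval_I] P F_Suc by metis
  qed
  have prim: "primitive_on I (F (Suc n)) (\<lambda>t. K t (F n t))" and init: "F (Suc n) c = 0" for n
    using P[OF F_cont] by (auto simp: F_Suc)
  have F_le: "norm (F n x) \<le> norm y0 * \<bar>\<kappa> x\<bar> ^ n / fact n" if "x \<in> I" for n x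
    by (rule iterate_norm_le[where F = F, OF order_refl interval_I c prim init _ that]) (simp add: F_def)
  have exp_sums: "(\<lambda>n. norm y0 * r ^ n / fact n) sums (norm y0 * exp r)" for r :: real
    using sums_mult[OF exp_converges[of r], of "norm y0"] by (simp add: field_simps scaleR_conv_of_real)
  have F_summable: "summable (\<lambda>n. norm (F n x))" if "x \<in> I" for x
    by (rule summable_comparison_test[OF _ sums_summable[OF exp_sums[of "\<bar>\<kappa> x\<bar>"]]])
      (use F_le[OF that] in auto)
  define y where "y x = (\<Sum>n. F n x)" for x
  have partial_le: "norm (\<Sum>n<m. F n x) \<le> norm y0 * exp \<bar>\<kappa> x\<bar>" if "x \<in> I" for m x
  proof -
    have "norm (\<Sum>n<m. F n x) \<le> (\<Sum>n<m. norm y0 * \<bar>\<kappa> x\<bar> ^ n / fact n)"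
      by (rule sum_norm_le) (use F_le[OF that] in auto)
    also have "\<dots> \<le> norm y0 * exp \<bar>\<kappa> x\<bar>"
      using sum_le_suminf[OF sums_summable[OF exp_sums], of "{..<m}" "\<bar>\<kappa> x\<bar>"] sums_unique[OF exp_sums[of "\<bar>\<kappa> x\<bar>"]]
      by (simp add: zero_le_divide_iff)
    finally show ?thesis .
  qed
  have lim: "(\<lambda>m. \<Sum>n<m. F n x) \<longlonglongrightarrow> y x" if "x \<in> I" for x
    unfolding y_def using summable_LIMSEQ[OF summable_norm_cancel[OF F_summable[OF that]]] .
  have y_le: "norm (y x) \<le> norm y0 * exp \<bar>\<kappa> x\<bar>" if "x \<in> I" for x
    by (rule tendsto_upperbound[OF tendsto_norm[OF lim[OF that]]]) (use partial_le[OF that] in auto)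
  have y_c: "y c = y0"
  proof -
    have "F n c = (if n = 0 then y0 else 0)" for n
      using init by (cases n) (auto simp: F_def)
    then show ?thesis
      using suminf_finite[of "{0}" "\<lambda>n. if n = 0 then y0 else 0"] by (simp add: y_def)
  qed
  have cont_on: "continuous_on {x..z} y" if xz: "x \<in> I" "z \<in> I" for x z
  proof -
    define R where "R = max \<bar>\<kappa> x\<bar> \<bar>\<kappa> z\<bar>"
    have "uniform_limit {x..z} (\<lambda>m t. \<Sum>n<m. F n t) (\<lambda>t. suminf (\<lambda>n. F n t)) sequentially"
    proof (rule Weierstrass_m_test)
      fix n t assume t: "t \<in> {x..z}"
      then have tI: "t \<in> I" using Icc_subset_interval[OF interval_I xz] by auto
      have "\<bar>\<kappa> t\<bar> ^ n \<le> R ^ n"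
        using \<kappa>_bounded[OF xz t] by (intro power_mono) (auto simp: R_def)
      then have "norm y0 * \<bar>\<kappa> t\<bar> ^ n / fact n \<le> norm y0 * R ^ n / fact n"
        by (intro divide_right_mono mult_left_mono) auto
      then show "norm (F n t) \<le> norm y0 * R ^ n / fact n"
        using F_le[OF tI, of n] by linarith
    qed (rule sums_summable[OF exp_sums])
    then show ?thesis
      unfolding y_def[abs_def]
    proof (rule uniform_limit_theorem[rotated])
      show "\<forall>\<^sub>F m in sequentially. continuous_on {x..z} (\<lambda>t. \<Sum>n<m. F n t)"
        by (intro always_eventually allI continuous_on_sum continuous_on_subset[OF F_cont]
            Icc_subset_interval[OF interval_I xz])
    qed simp
  qed
  have y_cont: "continuous_on I y"
  proof -
    have "isCont y x" if x: "x \<in> I" for x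
    proof -
      obtain d where d: "d > 0" "{x - d..x + d} \<subseteq> I"
        using open_interval_neighbourhood[OF open_I interval_I x] by blast
      then have "x - d \<in> I" "x + d \<in> I" by auto
      then have "continuous_on {x - d<..<x + d} y"
        using continuous_on_subset[OF cont_on] by (meson greaterThanLessThan_subseteq_atLeastAtMost_iff order_refl)
      then show ?thesis
        using d(1) by (simp add: continuous_on_eq_continuous_at)
    qed
    then show ?thesis by (simp add: continuous_at_imp_continuous_on)
  qed
  have "primitive_on I y (\<lambda>t. K t (y t))"
    unfolding primitive_on_def
  proof (intro conjI ballI impI integrable_K y_cont)
    fix x z assume xz: "x \<in> I" "z \<in> I" "x \<le> z"
    define S where "S m t = (\<Sum>n<m. F n t)" for m t
    define R where "R = max \<bar>\<kappa> x\<bar> \<bar>\<kappa> z\<bar>"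
    have tI: "t \<in> I" if "t \<in> {x..z}" for t
      using Icc_subset_interval[OF interval_I xz(1,2)] that by auto
    have S_cont: "continuous_on I (S m)" for m
      unfolding S_def by (intro continuous_on_sum F_cont)
    have KS: "primitive_on I (S (Suc m)) (\<lambda>t. K t (S m t))" for m
    proof (induction m)
      case 0
      have "primitive_on I (\<lambda>t. y0) (\<lambda>t. 0)"
        by (simp add: primitive_on_def integrable_within_def)
      then show ?case
        by (rule primitive_on_cong[OF interval_I, rotated 2])
          (auto simp: S_def F_def linear_0[OF linear_K])
    next
      case (Suc m)
      have "primitive_on I (\<lambda>t. S (Suc m) t + F (Suc m) t) (\<lambda>t. K t (S m t) + K t (F m t))"
        by (rule primitive_on_add[OF Suc prim])
      then show ?case
        by (rule primitive_on_cong[OF interval_I, rotated 2])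
          (auto simp: S_def linear_add[OF linear_K, symmetric])
    qed
    have "(\<lambda>m. integral {x..z} (\<lambda>t. K t (S m t))) \<longlonglongrightarrow> integral {x..z} (\<lambda>t. K t (y t))"
    proof (rule dominated_convergence(2))
      show "(\<lambda>t. K t (S m t)) integrable_on {x..z}" for m
        by (rule primitive_on_integrable(2)[OF KS xz(1,2)])
      show "(\<lambda>t. k t * (norm y0 * exp R)) integrable_on {x..z}"
        using integrable_on_mult_left[OF primitive_on_integrable(2)[OF primitive_\<kappa> xz(1,2)], of "norm y0 * exp R"] .
    next
      fix m t assume t: "t \<in> {x..z}"
      have "norm (K t (S m t)) \<le> k t * norm (S m t)" by (rule norm_K_le[OF tI[OF t]])
      also have "norm (S m t) \<le> norm y0 * exp \<bar>\<kappa> t\<bar>" unfolding S_def by (rule partial_le[OF tI[OF t]])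
      also have "\<dots> \<le> norm y0 * exp R"
        using \<kappa>_bounded[OF xz(1,2) t] by (intro mult_left_mono) (auto simp: R_def)
      finally show "norm (K t (S m t)) \<le> k t * (norm y0 * exp R)"
        using k_nonneg[OF tI[OF t]] by (simp add: mult_left_mono)
    next
      fix t assume t: "t \<in> {x..z}"
      have "bounded_linear (K t)" using linear_K[OF tI[OF t]] by (simp add: linear_conv_bounded_linear)
      then show "(\<lambda>m. K t (S m t)) \<longlonglongrightarrow> K t (y t)"
        unfolding S_def using bounded_linear.tendsto lim[OF tI[OF t]] by blast
    qed
    moreover have "integral {x..z} (\<lambda>t. K t (S m t)) = S (Suc m) z - S (Suc m) x" for m
      using primitive_onD[OF KS xz] by simp
    moreover have "(\<lambda>m. S (Suc m) z - S (Suc m) x) \<longlonglongrightarrow> y z - y x"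
      unfolding S_def
      by (intro tendsto_diff LIMSEQ_Suc[OF lim[OF xz(2)]] LIMSEQ_Suc[OF lim[OF xz(1)]])
    ultimately show "y z - y x = integral {x..z} (\<lambda>t. K t (y t))"
      using LIMSEQ_unique by simp
  qed
  with y_c y_le that show ?thesis by blast
qed

lemma solution_unique:
  assumes y: "primitive_on I y (\<lambda>t. K t (y t))" and w: "primitive_on I w (\<lambda>t. K t (w t))"
    and "y c = w c" and x: "x \<in> I"
  shows "y x = w x"
proof -
  have "primitive_on I (\<lambda>t. y t - w t) (\<lambda>t. K t (y t - w t))"
    by (rule primitive_on_cong[OF interval_I _ _ primitive_on_diff[OF y w]])
      (auto simp: linear_diff[OF linear_K])
  from solution_zero[OF this _ x] assms(3) show ?thesis by simp
qed

text \<open>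
  Gronwall's inequality for solutions: by uniqueness each one is a sum of a Picard series.
\<close>

lemma solution_norm_le:
  assumes y: "primitive_on I y (\<lambda>t. K t (y t))" and x: "x \<in> I"
  shows "norm (y x) \<le> norm (y c) * exp \<bar>\<kappa> x\<bar>"
  using solution_exists[of "y c"] solution_unique[OF y _ _ x] x by metis

end

section \<open>Solutions as pairs of a function and its quasi-derivative\<close>

text \<open>
  The equation \<open>- (x powr \<alpha> u')' + q u = 0\<close> as a first order system, with \<open>v\<close> standing for the
  quasi-derivative \<open>x powr \<alpha> u'\<close>. A spectral parameter is absorbed into \<open>q\<close>. Solutions may be real
  or complex valued: comparison takes place over the reals, the limit point property concerns complex
  solutions.
\<close>

definition solution_pair :: "real \<Rightarrow> (real \<Rightarrow> 'a::{real_normed_field,euclidean_space}) \<Rightarrow> real set \<Rightarrow>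
    (real \<Rightarrow> 'a) \<Rightarrow> (real \<Rightarrow> 'a) \<Rightarrow> bool" where
  "solution_pair \<alpha> q I u v \<longleftrightarrow>
     primitive_on I u (\<lambda>t. (t powr - \<alpha>) *\<^sub>R v t) \<and> primitive_on I v (\<lambda>t. q t * u t)"

lemma solution_pair_subset: "solution_pair \<alpha> q I u v \<Longrightarrow> J \<subseteq> I \<Longrightarrow> solution_pair \<alpha> q J u v"
  by (auto simp: solution_pair_def intro: primitive_on_subset)

lemma solution_pair_spike:
  assumes "solution_pair \<alpha> q I u v" "is_interval I" "negligible N" "\<And>t. t \<in> I - N \<Longrightarrow> q' t = q t"
  shows "solution_pair \<alpha> q' I u v"
  using assms(1) primitive_on_spike[OF assms(3) _ assms(2), where F = v and g = "\<lambda>t. q' t * u t" and f = "\<lambda>t. q t * u t"]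
    assms(4) by (auto simp: solution_pair_def)

lemma solution_pair_of_real:
  assumes "solution_pair \<alpha> q I u v"
  shows "solution_pair \<alpha> (\<lambda>t. complex_of_real (q t)) I (\<lambda>t. of_real (u t)) (\<lambda>t. of_real (v t))"
  using assms primitive_on_linear[OF bounded_linear_of_real[where 'a = complex]]
  by (auto simp: solution_pair_def scaleR_conv_of_real simp flip: of_real_mult)

lemma powr_continuous_on_pos: "I \<subseteq> {0<..} \<Longrightarrow> continuous_on I (\<lambda>t::real. t powr a)"
  by (intro continuous_intros) auto

lemma solution_pair_continuous:
  assumes "open I" "is_interval I" "solution_pair \<alpha> q I u v"
  shows "continuous_on I u" "continuous_on I v"
  using assms primitive_on_continuous by (auto simp: solution_pair_def)

lemma solution_pair_has_derivative:
  assumes I: "open I" "is_interval I" "I \<subseteq> {0<..}" and uv: "solution_pair \<alpha> q I u v" and x: "x \<in> I"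
  shows "(u has_vector_derivative (x powr - \<alpha>) *\<^sub>R v x) (at x)"
  using uv x solution_pair_continuous(2)[OF I(1,2) uv]
  by (intro primitive_on_continuous_has_derivative[OF I(1,2)] continuous_on_scaleR powr_continuous_on_pos I)
    (auto simp: solution_pair_def)

lemma norm_fst_snd_le: "norm (fst p) \<le> norm p" "norm (snd p) \<le> norm p"
  by (metis norm_fst_le prod.collapse) (metis norm_snd_le prod.collapse)

lemma linear_equation_solution_pair:
  fixes q :: "real \<Rightarrow> 'a::{real_normed_field,euclidean_space}"
  assumes I: "open I" "is_interval I" "I \<subseteq> {0<..}" "c \<in> I" and q: "integrable_within I q"
  obtains k \<kappa> where "linear_equation I c (\<lambda>t p. ((t powr - \<alpha>) *\<^sub>R snd p, q t * fst p)) k \<kappa>"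
proof -
  define k where "k t = t powr - \<alpha> + norm (q t)" for t
  have k: "integrable_within I k"
    unfolding k_def[abs_def]
    by (intro integrable_within_add integrable_within_norm q integrable_within_continuous I powr_continuous_on_pos)
  obtain \<kappa> where \<kappa>: "primitive_on I \<kappa> k" "\<kappa> c = 0"
    using primitive_on_exists[OF I(2,4) k] .
  have "linear_equation I c (\<lambda>t p. ((t powr - \<alpha>) *\<^sub>R snd p, q t * fst p)) k \<kappa>"
  proof (rule linear_equation.intro)
    show "linear (\<lambda>p::'a \<times> 'a. ((t powr - \<alpha>) *\<^sub>R snd p, q t * fst p))" for t
      by (rule linearI) (auto simp: algebra_simps)
    fix t assume "t \<in> I"
    show "norm ((t powr - \<alpha>) *\<^sub>R snd p, q t * fst p) \<le> k t * norm p" for p :: "'a \<times> 'a"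
    proof -
      have "norm ((t powr - \<alpha>) *\<^sub>R snd p, q t * fst p)
          \<le> t powr - \<alpha> * norm (snd p) + norm (q t) * norm (fst p)"
        using norm_Pair_le[of "(t powr - \<alpha>) *\<^sub>R snd p" "q t * fst p"] by (simp add: norm_mult)
      also have "\<dots> \<le> t powr - \<alpha> * norm p + norm (q t) * norm p"
        by (intro add_mono mult_left_mono norm_fst_snd_le) simp_all
      finally show ?thesis by (simp add: k_def algebra_simps)
    qed
    show "0 \<le> k t" by (simp add: k_def)
  next
    fix y :: "real \<Rightarrow> 'a \<times> 'a" assume y: "continuous_on I y"
    show "integrable_within I (\<lambda>t. ((t powr - \<alpha>) *\<^sub>R snd (y t), q t * fst (y t)))"
      by (intro integrable_within_Pair integrable_within_continuous I continuous_intros powr_continuous_on_pos y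
          integrable_within_bilinear[OF bounded_bilinear.flip[OF bounded_bilinear_mult] I(2) _ q])
  qed (use I \<kappa> in auto)
  with that show ?thesis by blast
qed

lemma solution_pair_exists:
  fixes q :: "real \<Rightarrow> 'a::{real_normed_field,euclidean_space}"
  assumes I: "open I" "is_interval I" "I \<subseteq> {0<..}" "c \<in> I" and q: "integrable_within I q"
  obtains u v where "solution_pair \<alpha> q I u v" "u c = u0" "v c = v0"
proof -
  obtain k \<kappa> where E: "linear_equation I c (\<lambda>t p. ((t powr - \<alpha>) *\<^sub>R snd p, q t * fst p)) k \<kappa>"
    using linear_equation_solution_pair[OF I q] .
  obtain y where y: "primitive_on I y (\<lambda>t. ((t powr - \<alpha>) *\<^sub>R snd (y t), q t * fst (y t)))" "y c = (u0, v0)"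
    by (rule linear_equation.solution_exists[OF E, where ?y0.0 = "(u0, v0)"])
  have "solution_pair \<alpha> q I (\<lambda>t. fst (y t)) (\<lambda>t. snd (y t))"
    using primitive_on_linear[OF bounded_linear_fst y(1)] primitive_on_linear[OF bounded_linear_snd y(1)]
    by (simp add: solution_pair_def)
  with that y(2) show ?thesis by fastforce
qed

lemma solution_pair_zero:
  fixes q :: "real \<Rightarrow> 'a::{real_normed_field,euclidean_space}"
  assumes I: "open I" "is_interval I" "I \<subseteq> {0<..}" "c \<in> I" and q: "integrable_within I q"
    and uv: "solution_pair \<alpha> q I u v" "u c = 0" "v c = 0" and x: "x \<in> I"
  shows "u x = 0"
proof -
  obtain k \<kappa> where E: "linear_equation I c (\<lambda>t p. ((t powr - \<alpha>) *\<^sub>R snd p, q t * fst p)) k \<kappa>"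
    using linear_equation_solution_pair[OF I q] .
  have "primitive_on I (\<lambda>t. (u t, v t)) (\<lambda>t. ((t powr - \<alpha>) *\<^sub>R v t, q t * u t))"
    using uv(1) by (intro primitive_on_Pair) (auto simp: solution_pair_def)
  from linear_equation.solution_zero[OF E, of "\<lambda>t. (u t, v t)"] this uv(2,3) x show ?thesis
    by (simp add: zero_prod_def)
qed

text \<open>
  In the derivative of the Wronskian the terms \<open>t powr - \<alpha> * v1 * v2\<close> cancel and only the difference of
  the potentials survives. With equal potentials the Wronskian is constant; with potentials that differ
  by \<open>z\<close> this is variation of constants; with ordered potentials it drives the comparison.
\<close>

lemma primitive_wronskian:
  assumes I: "open I" "is_interval I"
    and 1: "solution_pair \<alpha> q1 I u1 v1" and 2: "solution_pair \<alpha> q2 I u2 v2"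
  shows "primitive_on I (\<lambda>t. u1 t * v2 t - u2 t * v1 t) (\<lambda>t. (q2 t - q1 t) * u1 t * u2 t)"
  by (rule primitive_on_cong[OF I(2) _ _ primitive_on_diff[OF
        primitive_on_bilinear[OF bounded_bilinear_mult I, of u1 "\<lambda>t. (t powr - \<alpha>) *\<^sub>R v1 t" v2 "\<lambda>t. q2 t * u2 t"]
        primitive_on_bilinear[OF bounded_bilinear_mult I, of u2 "\<lambda>t. (t powr - \<alpha>) *\<^sub>R v2 t" v1 "\<lambda>t. q1 t * u1 t"]]])
    (use 1 2 in \<open>auto simp: solution_pair_def algebra_simps\<close>)

lemma einterval_0:
  shows open_einterval_0: "open (einterval 0 b)" and interval_einterval_0: "is_interval (einterval 0 b)"
    and einterval_0_pos: "einterval 0 b \<subseteq> {0<..}"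
proof -
  show "is_interval (einterval 0 b)"
    unfolding is_interval_1
    by (auto simp: einterval_iff) (meson ereal_less_eq(3) le_less_trans)
qed (auto simp: einterval_iff)

lemma locally_L1_on_integrable_within:
  assumes "locally_L1_on I q" "is_interval I"
  shows "integrable_within I q"
  unfolding integrable_within_def
proof (intro ballI)
  fix x y assume "x \<in> I" "y \<in> I"
  then show "q absolutely_integrable_on {x..y}"
    using assms(1) Icc_subset_interval[OF assms(2)] by (simp add: locally_L1_on_def)
qed

text \<open>
  The quasi-derivative of \<open>u\<close> is \<open>v\<close> on the whole interval, and \<open>v\<close> is differentiable almost everywhere
  with the derivative prescribed by the equation.
\<close>

lemma solution_pair_is_solution:
  assumes "solution_pair \<alpha> (\<lambda>t. q t - z) (einterval 0 b) u v"
  shows "is_solution \<alpha> q b z u"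
proof -
  let ?I = "einterval 0 b"
  note I = open_einterval_0[of b] interval_einterval_0[of b] einterval_0_pos[of b]
  have u: "primitive_on ?I u (\<lambda>t. (t powr - \<alpha>) *\<^sub>R v t)" and v: "primitive_on ?I v (\<lambda>t. (q t - z) * u t)"
    using assms by (auto simp: solution_pair_def)
  have der: "(u has_vector_derivative (x powr - \<alpha>) *\<^sub>R v x) (at x)" if "x \<in> ?I" for x
    by (rule solution_pair_has_derivative[OF I assms that])
  have quasi: "quasi_deriv \<alpha> u x = v x" if "x \<in> ?I" for x
  proof -
    have "x > 0" using that I(3) by auto
    then have "x powr \<alpha> * x powr - \<alpha> = 1" by (simp flip: powr_add)
    then show ?thesis
      by (simp add: quasi_deriv_def vector_derivative_at[OF der[OF that]])
  qed
  have v': "primitive_on ?I (quasi_deriv \<alpha> u) (\<lambda>t. (q t - z) * u t)"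
    by (rule primitive_on_cong[OF I(2) _ _ v]) (auto simp: quasi)
  show ?thesis
    unfolding is_solution_def
  proof (intro conjI ballI)
    show "locally_abs_continuous_on ?I u" "locally_abs_continuous_on ?I (quasi_deriv \<alpha> u)"
      by (rule primitive_on_abs_continuous[OF u I(2)] primitive_on_abs_continuous[OF v' I(2)])+
    show "u differentiable at x" if "x \<in> ?I" for x
      using der[OF that] by (auto simp: differentiable_def has_vector_derivative_def)
    show "AE x in lebesgue. x \<in> ?I \<longrightarrow>
        (\<exists>D. (quasi_deriv \<alpha> u has_vector_derivative D) (at x) \<and> - D + q x * u x = z * u x)"
      using primitive_on_has_derivative_ae[OF I(1,2) v']
    proof (rule eventually_mono, intro impI)
      fix x assume "x \<in> ?I \<longrightarrow> (quasi_deriv \<alpha> u has_vector_derivative (q x - z) * u x) (at x)" "x \<in> ?I"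
      then show "\<exists>D. (quasi_deriv \<alpha> u has_vector_derivative D) (at x) \<and> - D + q x * u x = z * u x"
        by (intro exI[of _ "(q x - z) * u x"]) (auto simp: algebra_simps)
    qed
  qed
qed

lemma square_sum_le: "((a::real) + b)\<^sup>2 \<le> 2 * (a\<^sup>2 + b\<^sup>2)"
  using sum_squares_bound[of a b] by (simp add: power2_sum)

text \<open>
  The half of Weyl's alternative that transfers the limit point property between spectral parameters.
  Suppose that the solutions \<open>u1\<close>, \<open>u2\<close> for \<open>z\<close> with Wronskian \<open>1\<close> are square integrable near \<open>0\<close>, and
  write \<open>f = A u1 + B u2\<close>, where the coefficients \<open>A\<close> and \<open>B\<close> are the Wronskians of \<open>f\<close> with \<open>u2\<close> and of
  \<open>u1\<close> with \<open>f\<close>. They solve a linear system of size at most \<open>\<bar>z\<bar> (\<bar>u1\<bar> + \<bar>u2\<bar>)\<^sup>2\<close>, which is integrable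
  up to \<open>0\<close>. By Gronwall's inequality \<open>A\<close> and \<open>B\<close> are bounded near \<open>0\<close>, so \<open>f\<close> is square integrable.
\<close>

lemma limit_point_of_non_L2_solution:
  assumes q: "locally_L1_on (einterval 0 b) q"
    and fw: "solution_pair \<alpha> q (einterval 0 b) f w" and f: "\<not> L2_near_0 b f"
    and c0: "c0 \<in> einterval 0 b"
  shows "limit_point_at_0 \<alpha> q b"
  unfolding limit_point_at_0_def
proof (intro allI, rule ccontr)
  fix z :: complex
  assume no: "\<nexists>u. is_solution \<alpha> q b z u \<and> \<not> L2_near_0 b u"
  let ?I = "einterval 0 b"
  note I = open_einterval_0[of b] interval_einterval_0[of b] einterval_0_pos[of b]
  have "integrable_within ?I (\<lambda>t. q t - z)"
    by (intro integrable_within_diff locally_L1_on_integrable_within[OF q] integrable_within_continuous I) auto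
  note ex = solution_pair_exists[OF I c0 this, where \<alpha> = \<alpha>]
  obtain u1 v1 where 1: "solution_pair \<alpha> (\<lambda>t. q t - z) ?I u1 v1" "u1 c0 = 1" "v1 c0 = 0" by (rule ex)
  obtain u2 v2 where 2: "solution_pair \<alpha> (\<lambda>t. q t - z) ?I u2 v2" "u2 c0 = 0" "v2 c0 = 1" by (rule ex)
  note cont = solution_pair_continuous[OF I(1,2)]
  have "L2_near_0 b u1" "L2_near_0 b u2"
    using no 1(1) 2(1) solution_pair_is_solution by blast+
  then obtain c1 c2 where c12: "c1 \<in> ?I" "c2 \<in> ?I"
    and int1: "integrable (lebesgue_on {0<..<c1}) (\<lambda>x. (norm (u1 x))\<^sup>2)"
    and int2: "integrable (lebesgue_on {0<..<c2}) (\<lambda>x. (norm (u2 x))\<^sup>2)"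
    by (auto simp: L2_near_0_def)
  (* Halving keeps c strictly inside both intervals of integrability, so that closed subintervals
     ending at c are covered. *)
  define c where "c = min c1 c2 / 2"
  have c_pos: "0 < c" "c < c1" "c < c2" using c12 by (auto simp: c_def einterval_iff)
  have sub: "{0<..c} \<subseteq> ?I"
    using c_pos c12(1) by (auto simp: einterval_iff) (meson ereal_less_eq(3) le_less_trans less_imp_le)
  have cI: "c \<in> ?I" using sub c_pos by auto
  define g where "g t = norm (u1 t) + norm (u2 t)" for t
  define h where "h t = 2 * ((norm (u1 t))\<^sup>2 + (norm (u2 t))\<^sup>2)" for t
  have g_h: "(g t)\<^sup>2 \<le> h t" for t unfolding g_def h_def by (rule square_sum_le)
  have hint: "h integrable_on {0<..c}"
  proof -
    have "(\<lambda>x. (norm (u1 x))\<^sup>2) absolutely_integrable_on {0<..<c1}" "(\<lambda>x. (norm (u2 x))\<^sup>2) absolutely_integrable_on {0<..<c2}"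
      using int1 int2 by (auto simp: set_integrable_def integrable_restrict_space)
    then have "(\<lambda>x. (norm (u1 x))\<^sup>2) absolutely_integrable_on {0<..c}" "(\<lambda>x. (norm (u2 x))\<^sup>2) absolutely_integrable_on {0<..c}"
      using c_pos by (auto intro: set_integrable_subset)
    then show ?thesis
      unfolding h_def by (intro integrable_on_mult_right integrable_add) (auto intro: set_lebesgue_integral_eq_integral(1))
  qed
  have W: "u1 t * v2 t - u2 t * v1 t = 1" if t: "t \<in> ?I" for t
  proof -
    have P: "primitive_on ?I (\<lambda>t. u1 t * v2 t - u2 t * v1 t) (\<lambda>t. 0)"
      using primitive_wronskian[OF I(1,2) 1(1) 2(1)] by simp
    have "u1 t * v2 t - u2 t * v1 t = u1 c0 * v2 c0 - u2 c0 * v1 c0"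
      using primitive_onD[OF P c0 t] primitive_onD[OF P t c0] by (cases "c0 \<le> t") auto
    then show ?thesis using 1 2 by simp
  qed
  define A where "A t = f t * v2 t - u2 t * w t" for t
  define B where "B t = u1 t * w t - f t * v1 t" for t
  have f_eq: "f t = A t * u1 t + B t * u2 t" if "t \<in> ?I" for t
  proof -
    have "A t * u1 t + B t * u2 t = f t * (u1 t * v2 t - u2 t * v1 t)"
      by (simp add: A_def B_def algebra_simps)
    then show ?thesis by (simp add: W[OF that])
  qed
  define K where "K t p = (- z * u2 t * (fst p * u1 t + snd p * u2 t), z * u1 t * (fst p * u1 t + snd p * u2 t))" for t p
  define k where "k t = norm z * (g t)\<^sup>2" for t
  have k_cont: "continuous_on ?I k"
    unfolding k_def[abs_def] g_def by (intro continuous_intros cont[OF 1(1)] cont[OF 2(1)])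
  obtain \<kappa> where \<kappa>: "primitive_on ?I \<kappa> k" "\<kappa> c = 0"
    using primitive_on_exists[OF I(2) cI integrable_within_continuous[OF I(2) k_cont]] .
  interpret linear_equation ?I c K k \<kappa>
  proof (rule linear_equation.intro)
    show "linear (K t)" for t
      by (rule linearI) (auto simp: K_def algebra_simps scaleR_conv_of_real)
    show "norm (K t p) \<le> k t * norm p" for t p
    proof -
      have "norm (fst p * u1 t + snd p * u2 t) \<le> norm (fst p) * norm (u1 t) + norm (snd p) * norm (u2 t)"
        using norm_triangle_ineq[of "fst p * u1 t" "snd p * u2 t"] by (simp add: norm_mult)
      also have "\<dots> \<le> norm p * norm (u1 t) + norm p * norm (u2 t)"
        by (intro add_mono mult_right_mono norm_fst_snd_le) simp_all
      also have "\<dots> = norm p * g t" by (simp add: g_def algebra_simps)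
      finally have le: "norm (fst p * u1 t + snd p * u2 t) \<le> norm p * g t" .
      have pair: "norm (- z * u2 t * e, z * u1 t * e) \<le> norm z * g t * norm e" for e
        using norm_Pair_le[of "- z * u2 t * e" "z * u1 t * e"] by (simp add: norm_mult g_def algebra_simps)
      have "norm (K t p) \<le> norm z * g t * norm (fst p * u1 t + snd p * u2 t)"
        unfolding K_def by (rule pair)
      also have "\<dots> \<le> norm z * g t * (norm p * g t)"
        by (intro mult_left_mono le) (auto simp: g_def)
      finally show ?thesis by (simp add: k_def power2_eq_square algebra_simps)
    qed
    show "integrable_within ?I (\<lambda>t. K t (y t))" if "continuous_on ?I y" for y
      unfolding K_def by (intro integrable_within_continuous I continuous_intros cont[OF 1(1)] cont[OF 2(1)] that)
  qed (use I \<kappa> cI in \<open>auto simp: k_def\<close>)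
  have "primitive_on ?I (\<lambda>t. (A t, B t)) (\<lambda>t. K t (A t, B t))"
    unfolding K_def fst_conv snd_conv
  proof (rule primitive_on_cong[OF I(2) _ _ primitive_on_Pair[OF primitive_wronskian[OF I(1,2) fw 2(1)]
          primitive_wronskian[OF I(1,2) 1(1) fw]]])
    fix t assume "t \<in> ?I"
    then show "((q t - z - q t) * f t * u2 t, (q t - (q t - z)) * u1 t * f t) =
       (- z * u2 t * (A t * u1 t + B t * u2 t), z * u1 t * (A t * u1 t + B t * u2 t))"
      by (simp add: f_eq[symmetric])
  qed (auto simp: A_def B_def)
  note AB_le = solution_norm_le[OF this]
  define R where "R = norm z * integral {0<..c} h"
  have \<kappa>_le: "\<bar>\<kappa> x\<bar> \<le> R" if x: "x \<in> {0<..c}" for x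
  proof -
    have xI: "x \<in> ?I" using x sub by auto
    have sx: "{x..c} \<subseteq> {0<..c}" using x by auto
    have hx: "h integrable_on {x..c}" using integrable_on_subinterval[OF hint sx] .
    have "\<kappa> c - \<kappa> x = integral {x..c} k" using primitive_onD[OF \<kappa>(1) xI cI] x by simp
    also have "\<dots> \<le> integral {x..c} (\<lambda>t. norm z * h t)"
      by (intro integral_le primitive_on_integrable[OF \<kappa>(1) xI cI] integrable_on_mult_right hx)
        (auto simp: k_def intro!: mult_left_mono g_h)
    also have "\<dots> = norm z * integral {x..c} h" by simp
    also have "\<dots> \<le> R"
      unfolding R_def by (intro mult_left_mono integral_subset_le sx hint hx) (auto simp: h_def)
    finally have "- \<kappa> x \<le> R" using \<kappa>(2) by simp
    moreover have "\<kappa> x \<le> 0" using \<kappa>_mono[OF xI cI] x \<kappa>(2) by simp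
    ultimately show ?thesis by simp
  qed
  define M where "M = norm (A c, B c) * exp R"
  have f_le: "(norm (f t))\<^sup>2 \<le> M\<^sup>2 * h t" if t: "t \<in> {0<..c}" for t
  proof -
    have tI: "t \<in> ?I" using t sub by auto
    have "norm (A t, B t) \<le> norm (A c, B c) * exp \<bar>\<kappa> t\<bar>" by (rule AB_le[OF tI])
    also have "\<dots> \<le> M"
      unfolding M_def using \<kappa>_le[OF t] by (intro mult_left_mono) auto
    finally have M: "norm (A t, B t) \<le> M" .
    have "norm (A t) \<le> M" "norm (B t) \<le> M"
      using norm_fst_snd_le[of "(A t, B t)"] M by auto
    then have "norm (f t) \<le> M * norm (u1 t) + M * norm (u2 t)"
      unfolding f_eq[OF tI]
      by (intro order_trans[OF norm_triangle_ineq] add_mono) (auto simp: norm_mult intro: mult_right_mono)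
    then have "norm (f t) \<le> M * g t" by (simp add: g_def algebra_simps)
    then have "(norm (f t))\<^sup>2 \<le> (M * g t)\<^sup>2" by (rule power_mono) simp
    also have "\<dots> \<le> M\<^sup>2 * h t" by (simp add: power_mult_distrib mult_left_mono g_h)
    finally show ?thesis .
  qed
  have f_cont: "continuous_on {0<..<c} f"
    by (rule continuous_on_subset[OF cont(1)[OF fw]]) (use sub in auto)
  have "(\<lambda>t. (norm (f t))\<^sup>2) absolutely_integrable_on {0<..<c}"
  proof (rule measurable_bounded_by_integrable_imp_absolutely_integrable)
    show "(\<lambda>t. (norm (f t))\<^sup>2) \<in> borel_measurable (lebesgue_on {0<..<c})"
      by (rule continuous_imp_measurable_on_sets_lebesgue) (auto intro!: continuous_intros f_cont)
    have "h absolutely_integrable_on {0<..c}"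
      using hint by (intro nonnegative_absolutely_integrable_1) (auto simp: h_def)
    then have "h absolutely_integrable_on {0<..<c}" by (rule set_integrable_subset) auto
    then show "(\<lambda>t. M\<^sup>2 * h t) integrable_on {0<..<c}"
      by (intro integrable_on_mult_right) (rule set_lebesgue_integral_eq_integral(1))
  qed (use f_le in auto)
  then have "integrable (lebesgue_on {0<..<c}) (\<lambda>t. (norm (f t))\<^sup>2)"
    by (rule absolutely_integrable_imp_integrable) auto
  moreover have "f \<in> borel_measurable (lebesgue_on {0<..<c})"
    by (rule continuous_imp_measurable_on_sets_lebesgue[OF f_cont]) auto
  ultimately have "L2_near_0 b f" using cI by (auto simp: L2_near_0_def)
  with f show False ..
qed

section \<open>Zeros and comparison\<close>

lemma AE_lebesgue_negligible:
  assumes "AE x in lebesgue. P x"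
  obtains N where "negligible N" "\<And>x. x \<notin> N \<Longrightarrow> P x"
  using assms unfolding eventually_ae_filter negligible_iff_null_sets by auto

text \<open>
  At an accumulation point of zeros both \<open>u\<close> and its derivative vanish, so \<open>u\<close> vanishes identically by
  uniqueness.
\<close>

lemma solution_pair_finite_zeros:
  fixes q u v :: "real \<Rightarrow> real"
  assumes I: "open I" "is_interval I" "I \<subseteq> {0<..}" and q: "integrable_within I q"
    and uv: "solution_pair \<alpha> q I u v" and nz: "c \<in> I" "u c \<noteq> 0" and xy: "x \<in> I" "y \<in> I"
  shows "finite {t\<in>{x..y}. u t = 0}"
proof (rule ccontr)
  define T where "T = {t\<in>{x..y}. u t = 0}"
  assume "\<not> finite {t\<in>{x..y}. u t = 0}"
  then have "infinite T" "T \<subseteq> {x..y}" by (auto simp: T_def)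
  then obtain l where l: "l \<in> {x..y}" "l islimpt T"
    using compact_Icc[of x y] unfolding compact_eq_Bolzano_Weierstrass by blast
  have lI: "l \<in> I" using Icc_subset_interval[OF I(2) xy] l(1) by auto
  have nontriv: "at l within T \<noteq> bot" using l(2) by (simp add: trivial_limit_within)
  have "isCont u l"
    using solution_pair_continuous(1)[OF I(1,2) uv] lI I(1) by (simp add: continuous_on_eq_continuous_at)
  then have "(u \<longlongrightarrow> u l) (at l within T)"
    by (simp add: continuous_at_imp_continuous_at_within continuous_within[symmetric])
  moreover have "(u \<longlongrightarrow> 0) (at l within T)"
    by (rule tendsto_eventually) (auto simp: eventually_at_filter T_def)
  ultimately have ul: "u l = 0" using tendsto_unique nontriv by blast
  have "(u has_field_derivative (l powr - \<alpha>) * v l) (at l within T)"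
    using solution_pair_has_derivative[OF I uv lI]
    by (auto simp: has_real_derivative_iff_has_vector_derivative intro: has_vector_derivative_at_within)
  then have "((\<lambda>t. (u t - u l) / (t - l)) \<longlongrightarrow> (l powr - \<alpha>) * v l) (at l within T)"
    by (simp add: has_field_derivative_iff)
  moreover have "((\<lambda>t. (u t - u l) / (t - l)) \<longlongrightarrow> 0) (at l within T)"
    by (rule tendsto_eventually) (auto simp: eventually_at_filter T_def ul)
  ultimately have "(l powr - \<alpha>) * v l = 0" using tendsto_unique nontriv by blast
  then have "v l = 0" using lI I(3) by auto
  from solution_pair_zero[OF I lI q uv ul this nz(1)] nz(2) show False by simp
qed

text \<open>
  While \<open>u\<close> is nonnegative, the Wronskian of \<open>f\<close> and \<open>u\<close> is increasing and vanishes at \<open>c\<close>, so it is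
  nonpositive to the left of \<open>c\<close>. It is the numerator of the derivative of \<open>u / f\<close>, a quotient that equals
  \<open>1\<close> at \<open>c\<close>.
\<close>

lemma comparison_of_nonneg:
  fixes q Q u v f F :: "real \<Rightarrow> real"
  assumes I: "open I" "is_interval I" "I \<subseteq> {0<..}"
    and fF: "solution_pair \<alpha> Q I f F" and uv: "solution_pair \<alpha> q I u v"
    and f: "\<And>t. t \<in> I \<Longrightarrow> 0 < f t" and Qq: "\<And>t. t \<in> I \<Longrightarrow> Q t \<le> q t"
    and c: "c \<in> I" "u c = f c" "v c = F c" and x: "x \<in> I" "x \<le> c"
    and u: "\<And>t. x \<le> t \<Longrightarrow> t \<le> c \<Longrightarrow> 0 \<le> u t"
  shows "f x \<le> u x"
proof -
  have xcI: "t \<in> I" if "x \<le> t" "t \<le> c" for t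
    using Icc_subset_interval[OF I(2) x(1) c(1)] that by auto
  have W_le: "f t * v t - u t * F t \<le> 0" if t: "x \<le> t" "t \<le> c" for t
  proof -
    have "f t * v t - u t * F t \<le> f c * v c - u c * F c"
    proof (rule primitive_on_mono[OF primitive_wronskian[OF I(1,2) fF uv] xcI[OF t] c(1) t(2)])
      fix s assume "t \<le> s" "s \<le> c"
      then have "s \<in> I" "0 \<le> u s" using t xcI u by auto
      then show "0 \<le> (q s - Q s) * f s * u s" using Qq f[of s] by simp
    qed
    then show ?thesis using c by simp
  qed
  have "u c / f c \<le> u x / f x"
  proof (rule DERIV_nonpos_imp_nonincreasing[OF x(2)])
    fix t assume t: "x \<le> t" "t \<le> c"
    then have tI: "t \<in> I" by (rule xcI)
    have u': "(u has_field_derivative (t powr - \<alpha>) * v t) (at t)"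
      and f': "(f has_field_derivative (t powr - \<alpha>) * F t) (at t)"
      using solution_pair_has_derivative[OF I uv tI] solution_pair_has_derivative[OF I fF tI]
      by (auto simp: has_real_derivative_iff_has_vector_derivative)
    have "((\<lambda>t. u t / f t) has_field_derivative
        ((t powr - \<alpha>) * v t * f t - u t * ((t powr - \<alpha>) * F t)) / (f t * f t)) (at t)"
      using f[OF tI] by (intro DERIV_divide u' f') auto
    moreover have "((t powr - \<alpha>) * v t * f t - u t * ((t powr - \<alpha>) * F t)) / (f t * f t)
        = (t powr - \<alpha>) * (f t * v t - u t * F t) / (f t * f t)"
      by (simp add: algebra_simps)
    moreover have "\<dots> \<le> 0"
      using W_le[OF t] by (intro divide_nonpos_nonneg mult_nonneg_nonpos) auto
    ultimately show "\<exists>D. ((\<lambda>t. u t / f t) has_field_derivative D) (at t) \<and> D \<le> 0" by auto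
  qed
  then have "1 \<le> u x / f x" using c f[of c] by simp
  then show ?thesis using f[OF x(1)] by simp
qed

text \<open>
  Nonnegativity of \<open>u\<close> comes for free: going left from \<open>c\<close>, the first zero \<open>s\<close> of \<open>u\<close> would satisfy
  \<open>u s \<ge> f s > 0\<close> by the previous lemma.
\<close>

lemma comparison:
  fixes q Q u v f F :: "real \<Rightarrow> real"
  assumes I: "open I" "is_interval I" "I \<subseteq> {0<..}"
    and fF: "solution_pair \<alpha> Q I f F" and uv: "solution_pair \<alpha> q I u v"
    and f: "\<And>t. t \<in> I \<Longrightarrow> 0 < f t" and Qq: "\<And>t. t \<in> I \<Longrightarrow> Q t \<le> q t"
    and c: "c \<in> I" "u c = f c" "v c = F c" and x: "x \<in> I" "x \<le> c"
  shows "f x \<le> u x"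
proof (rule comparison_of_nonneg[OF I fF uv f Qq c x])
  fix t assume t: "x \<le> t" "t \<le> c"
  have xcI: "s \<in> I" if "x \<le> s" "s \<le> c" for s
    using Icc_subset_interval[OF I(2) x(1) c(1)] that by auto
  have cont: "continuous_on {a..c} u" if "x \<le> a" for a
    by (rule continuous_on_subset[OF solution_pair_continuous(1)[OF I(1,2) uv]]) (use that xcI in auto)
  define Z where "Z = {s\<in>{t..c}. u s = 0}"
  show "0 \<le> u t"
  proof (rule ccontr)
    assume neg: "\<not> 0 \<le> u t"
    have uc: "0 < u c" using f[OF c(1)] c by simp
    obtain r where "t \<le> r" "r \<le> c" "u r = 0"
      using IVT'[of u t 0 c] neg uc t(2) cont[OF t(1)] by auto
    then have "Z \<noteq> {}" by (auto simp: Z_def)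
    moreover have "compact Z"
    proof -
      have "closed ({t..c} \<inter> u -` {0})"
        by (rule continuous_closed_preimage[OF cont[OF t(1)]]) auto
      then have "compact ({t..c} \<inter> ({t..c} \<inter> u -` {0}))"
        by (intro compact_Int_closed compact_Icc)
      moreover have "{t..c} \<inter> ({t..c} \<inter> u -` {0}) = Z" by (auto simp: Z_def)
      ultimately show ?thesis by simp
    qed
    ultimately obtain s where s: "s \<in> Z" "\<And>r. r \<in> Z \<Longrightarrow> r \<le> s"
      using compact_attains_sup[of Z] by metis
    have "f s \<le> u s"
    proof (rule comparison_of_nonneg[OF I fF uv f Qq c])
      show "s \<in> I" "s \<le> c" using s(1) t xcI by (auto simp: Z_def)
      fix r assume r: "s \<le> r" "r \<le> c"
      show "0 \<le> u r"
      proof (rule ccontr)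
        assume neg: "\<not> 0 \<le> u r"
        have "continuous_on {r..c} u" using r s(1) t by (intro cont) (auto simp: Z_def)
        then obtain r' where r': "r \<le> r'" "r' \<le> c" "u r' = 0"
          using IVT'[of u r 0 c] neg uc r by auto
        then have "r' \<in> Z" using r s(1) by (auto simp: Z_def)
        then have "r' \<le> s" by (rule s(2))
        then have "r = s" using r r' by simp
        then show False using neg s(1) by (simp add: Z_def)
      qed
    qed
    moreover have "0 < f s" using s(1) t xcI f by (auto simp: Z_def)
    ultimately show False using s(1) by (simp add: Z_def)
  qed
qed

text \<open>
  The real solution \<open>u\<close> with the Cauchy data of \<open>f\<close> at \<open>c\<close> dominates \<open>f\<close> on \<open>(0, c]\<close>. It witnesses
  nonoscillation, its zeros in \<open>[c, b)\<close> being isolated, and the limit point property for \<open>z = 0\<close>.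
\<close>

lemma positive_non_L2_comparison_criterion:
  fixes q :: "real \<Rightarrow> complex" and Q f F :: "real \<Rightarrow> real"
  assumes b: "0 < b" and q: "locally_L1_on (einterval 0 b) q"
    and real: "AE x in lebesgue. x \<in> einterval 0 b \<longrightarrow> q x \<in> \<real>"
    and \<delta>: "\<delta> > 0" and fF: "solution_pair \<alpha> Q {0<..<\<delta>} f F"
    and f: "\<And>t. t \<in> {0<..<\<delta>} \<Longrightarrow> 0 < f t"
    and Qq: "AE x in lebesgue. 0 < x \<and> x < \<delta> \<longrightarrow> Q x \<le> Re (q x)"
    and not_L2: "\<And>c. 0 < c \<Longrightarrow> c < \<delta> \<Longrightarrow> \<not> (\<lambda>t. (f t)\<^sup>2) integrable_on {0<..<c}"
  shows "nonoscillatory_at_0 \<alpha> q b \<and> limit_point_at_0 \<alpha> q b"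
proof -
  let ?I = "einterval 0 b" and ?J = "einterval 0 b \<inter> {0<..<\<delta>}"
  note I = open_einterval_0[of b] interval_einterval_0[of b] einterval_0_pos[of b]
  have J: "open ?J" "is_interval ?J" "?J \<subseteq> {0<..}"
    using I by (auto intro: is_interval_Int simp: is_interval_oo)
  obtain c where c: "c \<in> ?J"
  proof -
    have "0 < min (ereal \<delta>) b" using \<delta> b by simp
    then obtain c where "0 < ereal c" "ereal c < min (ereal \<delta>) b" using ereal_dense2 by blast
    then show thesis using that[of c] by (auto simp: einterval_iff)
  qed
  have below: "t \<in> ?J" if "0 < t" "t \<le> c" for t
    using that c by (auto simp: einterval_iff) (meson ereal_less_eq(3) le_less_trans)
  have qr: "integrable_within ?I (\<lambda>t. Re (q t))"
    by (rule integrable_within_linear[OF bounded_linear_Re locally_L1_on_integrable_within[OF q I(2)]])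
  have cI: "c \<in> ?I" using c by simp
  obtain u v where uv: "solution_pair \<alpha> (\<lambda>t. Re (q t)) ?I u v" "u c = f c" "v c = F c"
    by (rule solution_pair_exists[OF I cI qr])
  obtain N where N: "negligible N" "\<And>x. x \<notin> N \<Longrightarrow> 0 < x \<and> x < \<delta> \<longrightarrow> Q x \<le> Re (q x)"
    using AE_lebesgue_negligible[OF Qq] by blast
  (* Comparison needs Q \<le> q everywhere; changing q on a null set does not affect the solution. *)
  have uv': "solution_pair \<alpha> (\<lambda>t. max (Q t) (Re (q t))) ?J u v"
    by (rule solution_pair_spike[OF solution_pair_subset[OF uv(1)] J(2) N(1)]) (use N(2) in auto)
  have fF': "solution_pair \<alpha> Q ?J f F" by (rule solution_pair_subset[OF fF]) auto
  have f_le_u: "f t \<le> u t" if "0 < t" "t \<le> c" for t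
    by (rule comparison[OF J fF' uv' f _ c uv(2,3) below[OF that] that(2)]) auto
  have f_pos: "0 < f t" if "0 < t" "t \<le> c" for t using f below[OF that] by auto
  have u_pos: "0 < u t" if "0 < t" "t \<le> c" for t
    using f_le_u[OF that] f_pos[OF that] by simp
  define U V where "U t = complex_of_real (u t)" and "V t = complex_of_real (v t)" for t
  obtain N' where N': "negligible N'" "\<And>x. x \<notin> N' \<Longrightarrow> x \<in> ?I \<longrightarrow> q x \<in> \<real>"
    using AE_lebesgue_negligible[OF real] by blast
  have UV: "solution_pair \<alpha> q ?I U V"
    unfolding U_def V_def
    by (rule solution_pair_spike[OF solution_pair_of_real[OF uv(1)] I(2) N'(1)]) (use N'(2) in auto)
  have "nonoscillatory_at_0 \<alpha> q b"
    unfolding nonoscillatory_at_0_def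
  proof (intro exI[of _ U] conjI ballI)
    show "is_solution \<alpha> q b 0 U" using solution_pair_is_solution[of \<alpha> q 0] UV by simp
    show "U x \<in> \<real>" for x by (simp add: U_def)
    show "\<exists>x\<in>?I. U x \<noteq> 0" using cI u_pos[of c] c by (auto simp: U_def intro!: bexI[of _ c])
    fix c' assume c': "c' \<in> ?I"
    have "{x \<in> {0<..<c'}. U x = 0} \<subseteq> {t\<in>{c..c'}. u t = 0}"
      using u_pos by (force simp: U_def)
    moreover have "finite {t\<in>{c..c'}. u t = 0}"
      by (rule solution_pair_finite_zeros[OF I qr uv(1) cI _ cI c']) (use u_pos[of c] c in auto)
    ultimately show "finite {x \<in> {0<..<c'}. U x = 0}" by (rule finite_subset)
  qed
  moreover have "\<not> L2_near_0 b U"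
  proof
    assume "L2_near_0 b U"
    then obtain d where d: "d \<in> ?I" "integrable (lebesgue_on {0<..<d}) (\<lambda>x. (norm (U x))\<^sup>2)"
      by (auto simp: L2_near_0_def)
    define e where "e = min c d"
    have e: "0 < e" "e \<le> c" "e \<le> d" "e < \<delta>" using c d by (auto simp: e_def einterval_iff)
    have "(\<lambda>x. (u x)\<^sup>2) absolutely_integrable_on {0<..<d}"
      using d(2) by (simp add: U_def set_integrable_def integrable_restrict_space)
    then have "(\<lambda>x. (u x)\<^sup>2) absolutely_integrable_on {0<..<e}"
      using e by (auto intro: set_integrable_subset)
    then have u2: "(\<lambda>x. (u x)\<^sup>2) integrable_on {0<..<e}"
      by (rule set_lebesgue_integral_eq_integral(1))
    have "continuous_on {0<..<\<delta>} f"
      using solution_pair_continuous(1)[OF _ _ fF] by (simp add: is_interval_oo)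
    then have "continuous_on {0<..<e} f" using e by (auto intro: continuous_on_subset)
    then have "(\<lambda>x. (f x)\<^sup>2) \<in> borel_measurable (lebesgue_on {0<..<e})"
      by (intro continuous_imp_measurable_on_sets_lebesgue continuous_intros) auto
    then have "(\<lambda>x. (f x)\<^sup>2) absolutely_integrable_on {0<..<e}"
    proof (rule measurable_bounded_by_integrable_imp_absolutely_integrable[OF _ _ u2])
      fix x assume "x \<in> {0<..<e}"
      then have "0 < x" "x \<le> c" using e by auto
      then show "norm ((f x)\<^sup>2) \<le> (u x)\<^sup>2"
        using f_le_u[of x] f_pos[of x] by (simp add: power_mono)
    qed auto
    then have "(\<lambda>x. (f x)\<^sup>2) integrable_on {0<..<e}"
      by (rule set_lebesgue_integral_eq_integral(1))
    with not_L2[of e] e show False by simp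
  qed
  then have "limit_point_at_0 \<alpha> q b"
    by (rule limit_point_of_non_L2_solution[OF q UV _ cI])
  ultimately show ?thesis ..
qed

section \<open>The comparison functions\<close>

text \<open>
  The product \<open>P\<^sub>j\<close> of the introduction; \<open>log_weight_sum N\<close> is \<open>S\<close>.
\<close>

definition log_weight :: "nat \<Rightarrow> real \<Rightarrow> real" where
  "log_weight j x = (\<Prod>l=1..j. inverse (iter_ln l x))"

definition log_weight_sum :: "nat \<Rightarrow> real \<Rightarrow> real" where
  "log_weight_sum N x = (\<Sum>j=1..N. log_weight j x)"

definition comparison_potential :: "real \<Rightarrow> nat \<Rightarrow> real \<Rightarrow> real" where
  "comparison_potential \<alpha> N x = x powr (\<alpha> - 2) *
     ((3/4 - \<alpha>/2) - 1/2 * (2 - \<alpha>) * log_weight_sum N x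
       + 1/2 * (log_weight_sum N x)\<^sup>2 + 1/4 * (\<Sum>j=1..N. (log_weight j x)\<^sup>2))"

definition comparison_function :: "nat \<Rightarrow> real \<Rightarrow> real" where
  "comparison_function N x = sqrt (log_weight N x / x)"

text \<open>
  This is \<open>x powr \<alpha> * f'\<close> for the comparison function \<open>f\<close>, whose logarithmic derivative is
  \<open>(S - 1) / (2 * x)\<close>.
\<close>

definition comparison_quasi_deriv :: "real \<Rightarrow> nat \<Rightarrow> real \<Rightarrow> real" where
  "comparison_quasi_deriv \<alpha> N x =
     1/2 * x powr (\<alpha> - 1) * (log_weight_sum N x - 1) * comparison_function N x"

lemma log_weight_simps [simp]:
  "log_weight 0 x = 1" "log_weight (Suc j) x = log_weight j x * inverse (iter_ln (Suc j) x)"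
  by (simp_all add: log_weight_def)

lemma log_weight_sum_simps [simp]:
  "log_weight_sum 0 x = 0" "log_weight_sum (Suc N) x = log_weight_sum N x + log_weight (Suc N) x"
  by (simp_all add: log_weight_sum_def del: log_weight_simps)

lemma log_weight_pos: "(\<And>l. 1 \<le> l \<Longrightarrow> l \<le> j \<Longrightarrow> 0 < iter_ln l x) \<Longrightarrow> 0 < log_weight j x"
  unfolding log_weight_def by (intro prod_pos) auto

lemma filterlim_iter_ln: "filterlim (iter_ln j) at_top (at_right 0)"
proof (induction j)
  case 0
  then show ?case
    using filterlim_inverse_at_top_right by (simp add: inverse_eq_divide)
next
  case (Suc j)
  then show ?case
    using filterlim_compose[OF ln_at_top] by simp
qed

lemma iter_ln_pos_near_0:
  obtains \<delta> where "\<delta> > 0" "\<And>l x. l \<le> N \<Longrightarrow> 0 < x \<Longrightarrow> x < \<delta> \<Longrightarrow> 0 < iter_ln l x"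
proof -
  have "\<forall>\<^sub>F x in at_right 0. \<forall>l\<in>{..N}. 0 < iter_ln l x"
    using filterlim_iter_ln by (intro eventually_ball_finite) (auto simp: filterlim_at_top_dense)
  then show ?thesis
    using that by (auto simp: eventually_at_right[OF zero_less_one])
qed

text \<open>
  This is where the products \<open>P\<^sub>j\<close> come from: \<open>- P\<^sub>j / x\<close> is the derivative of \<open>ln\<^sub>j\<^sub>+\<^sub>1\<close>.
\<close>

lemma iter_ln_has_derivative:
  assumes "x > 0" "\<And>l. 1 \<le> l \<Longrightarrow> l \<le> j \<Longrightarrow> 0 < iter_ln l x"
  shows "(iter_ln (Suc j) has_real_derivative - (log_weight j x / x)) (at x)"
  using assms
proof (induction j)
  case 0
  have "((\<lambda>x. ln (1 / x)) has_real_derivative - (1 / x)) (at x)"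
    using 0 by (auto intro!: derivative_eq_intros simp: field_simps power2_eq_square)
  then show ?case by simp
next
  case (Suc j)
  have "0 < iter_ln (Suc j) x" by (rule Suc.prems(2)) auto
  moreover have "(iter_ln (Suc j) has_real_derivative - (log_weight j x / x)) (at x)"
    by (rule Suc.IH) (use Suc.prems in auto)
  ultimately have "((\<lambda>x. ln (iter_ln (Suc j) x)) has_real_derivative
      1 / iter_ln (Suc j) x * - (log_weight j x / x)) (at x)"
    by (intro DERIV_chain'[where f = "iter_ln (Suc j)" and g = ln] DERIV_ln_divide)
  then show ?case by (simp add: field_simps)
qed

lemma log_weight_has_derivative:
  assumes "x > 0" "\<And>l. 1 \<le> l \<Longrightarrow> l \<le> j \<Longrightarrow> 0 < iter_ln l x"
  shows "(log_weight j has_real_derivative log_weight j x * log_weight_sum j x / x) (at x)"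
  using assms
proof (induction j)
  case 0
  have "log_weight 0 = (\<lambda>x. 1)" by auto
  then show ?case by simp
next
  case (Suc j)
  have L: "0 < iter_ln (Suc j) x" by (rule Suc.prems(2)) auto
  have L': "(iter_ln (Suc j) has_real_derivative - (log_weight j x / x)) (at x)"
    using Suc.prems by (intro iter_ln_has_derivative) auto
  have IH: "(log_weight j has_real_derivative log_weight j x * log_weight_sum j x / x) (at x)"
    using Suc by simp
  have "((\<lambda>x. log_weight j x * inverse (iter_ln (Suc j) x)) has_real_derivative
      log_weight j x * log_weight_sum j x / x * inverse (iter_ln (Suc j) x)
      + - (inverse (iter_ln (Suc j) x) * - (log_weight j x / x) * inverse (iter_ln (Suc j) x)) * log_weight j x) (at x)"
    by (rule DERIV_mult[OF IH DERIV_inverse'[OF L']]) (use L in auto)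
  moreover have "log_weight (Suc j) = (\<lambda>x. log_weight j x * inverse (iter_ln (Suc j) x))" by auto
  ultimately show ?case
    using L Suc.prems(1) by (simp add: field_simps del: iter_ln.simps)
qed

text \<open>
  A double sum over \<open>l \<le> j\<close> is half of the full square together with half of the diagonal.
\<close>

lemma sum_log_weight_products:
  "(\<Sum>j=1..N. log_weight j x * log_weight_sum j x)
     = 1/2 * ((log_weight_sum N x)\<^sup>2 + (\<Sum>j=1..N. (log_weight j x)\<^sup>2))"
proof (induction N)
  case (Suc N)
  then show ?case
    by (simp add: field_simps power2_eq_square del: log_weight_simps)
qed simp

lemma log_weight_sum_has_derivative:
  assumes "x > 0" "\<And>l. 1 \<le> l \<Longrightarrow> l \<le> N \<Longrightarrow> 0 < iter_ln l x"
  shows "(log_weight_sum N has_real_derivative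
      1/2 * ((log_weight_sum N x)\<^sup>2 + (\<Sum>j=1..N. (log_weight j x)\<^sup>2)) / x) (at x)"
proof -
  have "((\<lambda>x. \<Sum>j=1..N. log_weight j x) has_real_derivative
      (\<Sum>j=1..N. log_weight j x * log_weight_sum j x / x)) (at x)"
    by (intro DERIV_sum log_weight_has_derivative) (use assms in auto)
  then show ?thesis
    by (simp only: sum_divide_distrib[symmetric] sum_log_weight_products flip: log_weight_sum_def)
qed

lemma comparison_function_has_derivative:
  assumes "x > 0" "\<And>l. 1 \<le> l \<Longrightarrow> l \<le> N \<Longrightarrow> 0 < iter_ln l x"
  shows "(comparison_function N has_real_derivative
      (log_weight_sum N x - 1) / (2 * x) * comparison_function N x) (at x)"
proof -
  let ?g = "\<lambda>x. log_weight N x / x"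
  have g: "?g x > 0" using log_weight_pos[of N x] assms by simp
  have "(?g has_real_derivative
      (log_weight N x * log_weight_sum N x / x * x - log_weight N x * 1) / (x * x)) (at x)"
    by (rule DERIV_divide[OF log_weight_has_derivative DERIV_ident]) (use assms in auto)
  also have "(log_weight N x * log_weight_sum N x / x * x - log_weight N x * 1) / (x * x)
      = (log_weight_sum N x - 1) / x * ?g x"
    using assms(1) by (simp add: field_simps)
  finally have "((\<lambda>x. sqrt (?g x)) has_real_derivative
      inverse (sqrt (?g x)) / 2 * ((log_weight_sum N x - 1) / x * ?g x)) (at x)"
    by (rule DERIV_chain'[where f = ?g and g = sqrt, OF _ DERIV_real_sqrt[OF g]])
  moreover have "inverse (sqrt (?g x)) / 2 * ((log_weight_sum N x - 1) / x * ?g x)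
      = (log_weight_sum N x - 1) / (2 * x) * sqrt (?g x)"
  proof -
    define s where "s = sqrt (?g x)"
    have "?g x = s * s" "s > 0" using g real_sqrt_mult_self[of "?g x"] by (auto simp only: s_def real_sqrt_gt_zero abs_of_pos)
    moreover from this have "inverse s / 2 * (a / x * (s * s)) = a / (2 * x) * s" for a
      using assms(1) by (simp add: field_simps)
    ultimately show ?thesis unfolding s_def[symmetric] by simp
  qed
  ultimately show ?thesis by (simp add: comparison_function_def[abs_def])
qed

text \<open>
  The potential is determined by the Riccati form of the equation: with \<open>\<phi> = f' / f = (S - 1) / (2 x)\<close>
  it is \<open>(x powr \<alpha> \<phi>)' + x powr \<alpha> \<phi>\<^sup>2\<close>. The quadratic terms in \<open>S\<close> arise from \<open>\<phi>\<^sup>2\<close> and from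
  \<open>S' = (S\<^sup>2 + P\<^sub>1\<^sup>2 + \<dots> + P\<^sub>N\<^sup>2) / (2 x)\<close>.
\<close>

lemma comparison_quasi_deriv_has_derivative:
  assumes "x > 0" "\<And>l. 1 \<le> l \<Longrightarrow> l \<le> N \<Longrightarrow> 0 < iter_ln l x"
  shows "(comparison_quasi_deriv \<alpha> N has_real_derivative
      comparison_potential \<alpha> N x * comparison_function N x) (at x)"
proof -
  define S T f where "S = log_weight_sum N x" and "T = (\<Sum>j=1..N. (log_weight j x)\<^sup>2)"
    and "f = comparison_function N x"
  have p: "((\<lambda>x. x powr (\<alpha> - 1)) has_real_derivative (\<alpha> - 1) * x powr (\<alpha> - 2)) (at x)"
    using has_real_derivative_powr[OF assms(1), of "\<alpha> - 1"] by simp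
  have S': "((\<lambda>x. log_weight_sum N x - 1) has_real_derivative 1/2 * (S\<^sup>2 + T) / x) (at x)"
    unfolding S_def T_def
    by (rule derivative_eq_intros log_weight_sum_has_derivative refl | use assms in simp)+
  have f': "(comparison_function N has_real_derivative (S - 1) / (2 * x) * f) (at x)"
    unfolding S_def f_def by (rule comparison_function_has_derivative) (use assms in auto)
  have "((\<lambda>x. 1/2 * (x powr (\<alpha> - 1) * (log_weight_sum N x - 1) * comparison_function N x)) has_real_derivative
      1/2 * (((\<alpha> - 1) * x powr (\<alpha> - 2) * (S - 1) + 1/2 * (S\<^sup>2 + T) / x * x powr (\<alpha> - 1)) * f
        + (S - 1) / (2 * x) * f * (x powr (\<alpha> - 1) * (S - 1)))) (at x)"
    unfolding S_def f_def
    by (intro DERIV_cmult DERIV_mult p S'[unfolded S_def] f'[unfolded S_def f_def])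
  also have "x powr (\<alpha> - 1) = x * x powr (\<alpha> - 2)"
    using assms(1) powr_mult_base[of x "\<alpha> - 2"] by simp
  also have "1/2 * (((\<alpha> - 1) * x powr (\<alpha> - 2) * (S - 1) + 1/2 * (S\<^sup>2 + T) / x * (x * x powr (\<alpha> - 2))) * f
        + (S - 1) / (2 * x) * f * (x * x powr (\<alpha> - 2) * (S - 1)))
      = x powr (\<alpha> - 2) * ((3/4 - \<alpha>/2) - 1/2 * (2 - \<alpha>) * S + 1/2 * S\<^sup>2 + 1/4 * T) * f"
    using assms(1) by (simp add: field_simps power2_eq_square)
  finally show ?thesis
    by (simp add: comparison_quasi_deriv_def[abs_def] comparison_potential_def S_def T_def f_def mult.assoc)
qed

lemma comparison_solution_pair:
  assumes "\<And>l x. l \<le> N \<Longrightarrow> 0 < x \<Longrightarrow> x < \<delta> \<Longrightarrow> 0 < iter_ln l x"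
  shows "solution_pair \<alpha> (comparison_potential \<alpha> N) {0<..<\<delta>} (comparison_function N) (comparison_quasi_deriv \<alpha> N)"
proof -
  let ?J = "{0<..<\<delta>}"
  have pos: "0 < iter_ln l x" if "x \<in> ?J" "l \<le> N" for l x using assms that by auto
  note D = DERIV_isCont[THEN continuous_at_imp_continuous_at_within]
  have cw: "continuous_on ?J (log_weight j)" if "j \<le> N" for j
    unfolding continuous_on_eq_continuous_within
    by (intro ballI D[OF log_weight_has_derivative]) (use pos that in auto)
  have cs: "continuous_on ?J (log_weight_sum N)"
    unfolding continuous_on_eq_continuous_within
    by (intro ballI D[OF log_weight_sum_has_derivative]) (use pos in auto)
  have cf: "continuous_on ?J (comparison_function N)"
    unfolding continuous_on_eq_continuous_within
    by (intro ballI D[OF comparison_function_has_derivative]) (use pos in auto)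
  have cF: "continuous_on ?J (comparison_quasi_deriv \<alpha> N)"
    unfolding continuous_on_eq_continuous_within
    by (intro ballI D[OF comparison_quasi_deriv_has_derivative]) (use pos in auto)
  have cp: "continuous_on ?J (\<lambda>t. t powr a)" for a by (rule powr_continuous_on_pos) auto
  have cQ: "continuous_on ?J (comparison_potential \<alpha> N)"
    unfolding comparison_potential_def[abs_def]
    by (intro continuous_intros cp cs cw) auto
  show ?thesis
    unfolding solution_pair_def
  proof (intro conjI primitive_on_of_derivative)
    show "continuous_on ?J (\<lambda>t. t powr - \<alpha> *\<^sub>R comparison_quasi_deriv \<alpha> N t)"
      by (intro continuous_on_scaleR cp cF)
    show "continuous_on ?J (\<lambda>t. comparison_potential \<alpha> N t * comparison_function N t)"
      by (intro continuous_on_mult cQ cf)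
    fix t assume t: "t \<in> ?J"
    show "(comparison_quasi_deriv \<alpha> N has_vector_derivative comparison_potential \<alpha> N t * comparison_function N t) (at t)"
      unfolding has_real_derivative_iff_has_vector_derivative[symmetric]
      by (rule comparison_quasi_deriv_has_derivative) (use t pos in auto)
    have "t powr - \<alpha> * t powr (\<alpha> - 1) = 1 / t"
      using t by (simp add: powr_minus_divide powr_diff)
    moreover have "t powr - \<alpha> * comparison_quasi_deriv \<alpha> N t
        = (t powr - \<alpha> * t powr (\<alpha> - 1)) * ((log_weight_sum N t - 1) / 2 * comparison_function N t)"
      by (simp add: comparison_quasi_deriv_def)
    ultimately have "t powr - \<alpha> * comparison_quasi_deriv \<alpha> N t
        = (log_weight_sum N t - 1) / (2 * t) * comparison_function N t"
      by simp
    then show "(comparison_function N has_vector_derivative t powr - \<alpha> *\<^sub>R comparison_quasi_deriv \<alpha> N t) (at t)"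
      unfolding has_real_derivative_iff_has_vector_derivative[symmetric] real_scaleR_def
      using comparison_function_has_derivative[of t N] t pos by auto
  qed (simp_all add: is_interval_oo)
qed

text \<open>
  The integral of the square over \<open>[x, c/2]\<close> is \<open>ln\<^sub>N\<^sub>+\<^sub>1 x - ln\<^sub>N\<^sub>+\<^sub>1 (c/2)\<close>, which is unbounded as \<open>x\<close>
  tends to \<open>0\<close>.
\<close>

lemma comparison_function_not_L2:
  assumes pos: "\<And>l x. l \<le> N \<Longrightarrow> 0 < x \<Longrightarrow> x < \<delta> \<Longrightarrow> 0 < iter_ln l x" and c: "0 < c" "c < \<delta>"
  shows "\<not> (\<lambda>t. (comparison_function N t)\<^sup>2) integrable_on {0<..<c}"
proof
  let ?g = "\<lambda>t. (comparison_function N t)\<^sup>2"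
  assume int: "?g integrable_on {0<..<c}"
  have g: "?g t = log_weight N t / t" if "0 < t" "t < \<delta>" for t
    using log_weight_pos[of N t] pos that by (simp add: comparison_function_def less_imp_le)
  have bound: "iter_ln (Suc N) x \<le> iter_ln (Suc N) (c/2) + integral {0<..<c} ?g" if x: "0 < x" "x < c/2" for x
  proof -
    have "((\<lambda>t. - (log_weight N t / t)) has_integral (iter_ln (Suc N) (c/2) - iter_ln (Suc N) x)) {x..c/2}"
    proof (rule fundamental_theorem_of_calculus)
      fix t assume t: "t \<in> {x..c/2}"
      have "(iter_ln (Suc N) has_real_derivative - (log_weight N t / t)) (at t)"
        by (rule iter_ln_has_derivative) (use t x c pos in auto)
      then show "(iter_ln (Suc N) has_vector_derivative - (log_weight N t / t)) (at t within {x..c/2})"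
        by (auto simp: has_real_derivative_iff_has_vector_derivative intro: has_vector_derivative_at_within)
    qed (use x in auto)
    from has_integral_neg[OF this]
    have "((\<lambda>t. log_weight N t / t) has_integral (iter_ln (Suc N) x - iter_ln (Suc N) (c/2))) {x..c/2}"
      by simp
    then have "(?g has_integral (iter_ln (Suc N) x - iter_ln (Suc N) (c/2))) {x..c/2}"
      by (rule has_integral_eq[rotated]) (use g x c in auto)
    then have "iter_ln (Suc N) x - iter_ln (Suc N) (c/2) = integral {x..c/2} ?g" "?g integrable_on {x..c/2}"
      by (auto simp: integral_unique)
    moreover have "integral {x..c/2} ?g \<le> integral {0<..<c} ?g"
      by (rule integral_subset_le) (use calculation int x c in auto)
    ultimately show ?thesis by linarith
  qed
  have "\<forall>\<^sub>F x in at_right 0. iter_ln (Suc N) (c/2) + integral {0<..<c} ?g < iter_ln (Suc N) x"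
    using filterlim_iter_ln[of "Suc N"] unfolding filterlim_at_top_dense by blast
  moreover have "\<forall>\<^sub>F x in at_right 0. 0 < x \<and> x < c/2"
    using c by (auto simp: eventually_at_right[OF zero_less_one] intro!: exI[of _ "c/2"])
  ultimately have "\<forall>\<^sub>F x in at_right (0::real). False"
    by eventually_elim (use bound in force)
  then show False by simp
qed

lemma log_weight_asymptotics:
  assumes "j \<ge> 1"
  shows "((\<lambda>x. iter_ln 1 x * log_weight j x) \<longlongrightarrow> (if j = 1 then 1 else 0)) (at_right 0)"
  using assms
proof (induction j rule: nat_induct_at_least)
  case base
  have "\<forall>\<^sub>F x in at_right 0. 0 < iter_ln 1 x"
    using filterlim_iter_ln[of 1] unfolding filterlim_at_top_dense by blast
  then have "\<forall>\<^sub>F x in at_right 0. iter_ln 1 x * log_weight 1 x = 1"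
    by eventually_elim (simp add: log_weight_def)
  then show ?case by (auto intro: tendsto_eventually)
next
  case (Suc j)
  have "((\<lambda>x. inverse (iter_ln (Suc j) x)) \<longlongrightarrow> 0) (at_right 0)"
    by (rule tendsto_inverse_0_at_top[OF filterlim_iter_ln])
  from tendsto_mult[OF Suc.IH this] Suc.hyps show ?case
    by (simp add: mult.assoc)
qed

text \<open>
  After multiplication by \<open>(ln\<^sub>1 x)\<^sup>2\<close> the quadratic terms of the potential converge to
  \<open>1/2 + 1/4 = 3/4\<close>, which the margin \<open>\<epsilon>\<close> turns into an inequality near \<open>0\<close>.
\<close>

lemma comparison_potential_le:
  assumes "N \<ge> 1" "\<epsilon> > 0"
  shows "\<forall>\<^sub>F x in at_right 0. comparison_potential \<alpha> N x \<le>
      (3/4 - \<alpha>/2) * x powr (\<alpha> - 2) - 1/2 * (2 - \<alpha>) * x powr (\<alpha> - 2) * log_weight_sum N x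
        + (3/4 + \<epsilon>) * x powr (\<alpha> - 2) * inverse ((iter_ln 1 x)\<^sup>2)"
proof -
  let ?L = "iter_ln 1"
  let ?R = "\<lambda>x. 1/2 * (log_weight_sum N x)\<^sup>2 + 1/4 * (\<Sum>j=1..N. (log_weight j x)\<^sup>2)"
  have factor: "1/2 * (\<Sum>j=1..N. l * g j)\<^sup>2 + 1/4 * (\<Sum>j=1..N. (l * g j)\<^sup>2)
      = l\<^sup>2 * (1/2 * (\<Sum>j=1..N. g j)\<^sup>2 + 1/4 * (\<Sum>j=1..N. (g j)\<^sup>2))" for l :: real and g :: "nat \<Rightarrow> real"
    by (simp add: power_mult_distrib algebra_simps flip: sum_distrib_left)
  have w: "((\<lambda>x. ?L x * log_weight j x) \<longlongrightarrow> (if j = 1 then 1 else 0)) (at_right 0)" if "j \<in> {1..N}" for j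
    using that by (intro log_weight_asymptotics) auto
  have "((\<lambda>x. 1/2 * (\<Sum>j=1..N. ?L x * log_weight j x)\<^sup>2 + 1/4 * (\<Sum>j=1..N. (?L x * log_weight j x)\<^sup>2)) \<longlongrightarrow>
      1/2 * (\<Sum>j=1..N. if j = 1 then 1 else 0)\<^sup>2 + 1/4 * (\<Sum>j=1..N. (if j = 1 then 1 else 0)\<^sup>2)) (at_right 0)"
    by (intro tendsto_intros w)
  moreover have "(\<Sum>j=1..N. (if j = 1 then 1 else 0)\<^sup>2) = (\<Sum>j=1..N. if j = 1 then 1 else 0 :: real)"
    by (intro sum.cong) auto
  moreover have "(\<Sum>j=1..N. if j = 1 then 1 else 0 :: real) = 1" using assms(1) by simp
  ultimately have "((\<lambda>x. (?L x)\<^sup>2 * ?R x) \<longlongrightarrow> 3/4) (at_right 0)"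
    unfolding factor log_weight_sum_def[symmetric] by simp
  then have "\<forall>\<^sub>F x in at_right 0. (?L x)\<^sup>2 * ?R x < 3/4 + \<epsilon>"
    using assms(2) by (auto dest!: order_tendstoD(2))
  moreover have "\<forall>\<^sub>F x in at_right 0. 0 < ?L x"
    using filterlim_iter_ln[of 1] unfolding filterlim_at_top_dense by blast
  ultimately show ?thesis
  proof eventually_elim
    case (elim x)
    have "?R x \<le> (3/4 + \<epsilon>) * inverse ((?L x)\<^sup>2)"
      using elim by (simp add: field_simps)
    then have "x powr (\<alpha> - 2) * ?R x \<le> x powr (\<alpha> - 2) * ((3/4 + \<epsilon>) * inverse ((?L x)\<^sup>2))"
      by (rule mult_left_mono) simp
    then show ?case by (simp add: comparison_potential_def algebra_simps)
  qed
qed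

lemma comparison_criterion:
  assumes b: "0 < b" and q: "locally_L1_on (einterval 0 b) q"
    and real: "AE x in lebesgue. x \<in> einterval 0 b \<longrightarrow> q x \<in> \<real>"
    and Qq: "ae_near_0 (\<lambda>x. comparison_potential \<alpha> N x \<le> Re (q x))"
  shows "nonoscillatory_at_0 \<alpha> q b \<and> limit_point_at_0 \<alpha> q b"
proof -
  obtain \<delta>1 where \<delta>1: "\<delta>1 > 0" "AE x in lebesgue. 0 < x \<and> x < \<delta>1 \<longrightarrow> comparison_potential \<alpha> N x \<le> Re (q x)"
    using Qq by (auto simp: ae_near_0_def)
  obtain \<delta>2 where \<delta>2: "\<delta>2 > 0" "\<And>l x. l \<le> N \<Longrightarrow> 0 < x \<Longrightarrow> x < \<delta>2 \<Longrightarrow> 0 < iter_ln l x"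
    using iter_ln_pos_near_0 by blast
  define \<delta> where "\<delta> = min \<delta>1 \<delta>2"
  have pos: "0 < iter_ln l x" if "l \<le> N" "0 < x" "x < \<delta>" for l x
    using \<delta>2(2) that by (simp add: \<delta>_def)
  show ?thesis
  proof (rule positive_non_L2_comparison_criterion[OF b q real])
    show "\<delta> > 0" using \<delta>1 \<delta>2 by (simp add: \<delta>_def)
    show "solution_pair \<alpha> (comparison_potential \<alpha> N) {0<..<\<delta>} (comparison_function N) (comparison_quasi_deriv \<alpha> N)"
      by (rule comparison_solution_pair[OF pos])
    show "0 < comparison_function N t" if "t \<in> {0<..<\<delta>}" for t
      using log_weight_pos[of N t] pos that by (simp add: comparison_function_def)
    show "AE x in lebesgue. 0 < x \<and> x < \<delta> \<longrightarrow> comparison_potential \<alpha> N x \<le> Re (q x)"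
      using \<delta>1(2) by (rule eventually_mono) (auto simp: \<delta>_def)
    show "\<not> (\<lambda>t. (comparison_function N t)\<^sup>2) integrable_on {0<..<c}" if "0 < c" "c < \<delta>" for c
      by (rule comparison_function_not_L2[OF pos that])
  qed
qed

lemma ae_near_0_mono:
  assumes "ae_near_0 P" "\<forall>\<^sub>F x in at_right 0. P x \<longrightarrow> R x"
  shows "ae_near_0 R"
proof -
  obtain \<delta>1 where \<delta>1: "\<delta>1 > 0" "AE x in lebesgue. 0 < x \<and> x < \<delta>1 \<longrightarrow> P x"
    using assms(1) by (auto simp: ae_near_0_def)
  obtain \<delta>2 where \<delta>2: "\<delta>2 > 0" "\<And>x. 0 < x \<Longrightarrow> x < \<delta>2 \<Longrightarrow> P x \<longrightarrow> R x"
    using assms(2) by (auto simp: eventually_at_right[OF zero_less_one])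
  have "AE x in lebesgue. 0 < x \<and> x < min \<delta>1 \<delta>2 \<longrightarrow> R x"
    using \<delta>1(2) by (rule eventually_mono) (use \<delta>2(2) in auto)
  with \<delta>1(1) \<delta>2(1) show ?thesis
    unfolding ae_near_0_def by (intro exI[of _ "min \<delta>1 \<delta>2"]) simp
qed

theorem theorem3p1:
  fixes b :: ereal and q :: "real \<Rightarrow> complex" and \<alpha> :: real
  assumes "0 < b"
    and "locally_L1_on (einterval 0 b) q"
    and "AE x in lebesgue. x \<in> einterval 0 b \<longrightarrow> q x \<in> \<real>"
  shows "(ae_near_0 (\<lambda>x. Re (q x) \<ge> (3/4 - \<alpha>/2) * x powr (\<alpha> - 2)) \<longrightarrow>
            nonoscillatory_at_0 \<alpha> q b \<and> limit_point_at_0 \<alpha> q b) \<and>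
         (\<alpha> < 2 \<and>
          (\<exists>N::nat. N \<ge> 1 \<and> (\<exists>\<epsilon>::real. \<epsilon> > 0 \<and>
            ae_near_0 (\<lambda>x. Re (q x) \<ge>
                (3/4 - \<alpha>/2) * x powr (\<alpha> - 2)
                - 1/2 * (2 - \<alpha>) * x powr (\<alpha> - 2)
                    * (\<Sum>j=1..N. \<Prod>l=1..j. inverse (iter_ln l x))
                + (3/4 + \<epsilon>) * x powr (\<alpha> - 2) * inverse ((iter_ln 1 x)\<^sup>2)))) \<longrightarrow>
            nonoscillatory_at_0 \<alpha> q b \<and> limit_point_at_0 \<alpha> q b)"
proof (intro conjI[of "_ \<longrightarrow> _"] impI)
  assume "ae_near_0 (\<lambda>x. Re (q x) \<ge> (3/4 - \<alpha>/2) * x powr (\<alpha> - 2))"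
  (* For N = 0 all logarithmic sums are empty. *)
  then have "ae_near_0 (\<lambda>x. comparison_potential \<alpha> 0 x \<le> Re (q x))"
    by (simp add: comparison_potential_def mult.commute)
  then show "nonoscillatory_at_0 \<alpha> q b \<and> limit_point_at_0 \<alpha> q b"
    by (rule comparison_criterion[OF assms])
next
  let ?B = "\<lambda>N \<epsilon> x. (3/4 - \<alpha>/2) * x powr (\<alpha> - 2)
                - 1/2 * (2 - \<alpha>) * x powr (\<alpha> - 2)
                    * (\<Sum>j=1..N. \<Prod>l=1..j. inverse (iter_ln l x))
                + (3/4 + \<epsilon>) * x powr (\<alpha> - 2) * inverse ((iter_ln 1 x)\<^sup>2)"
  assume "\<alpha> < 2 \<and> (\<exists>N::nat. N \<ge> 1 \<and> (\<exists>\<epsilon>::real. \<epsilon> > 0 \<and> ae_near_0 (\<lambda>x. Re (q x) \<ge> ?B N \<epsilon> x)))"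
  then obtain N :: nat and \<epsilon> :: real where N: "N \<ge> 1" and \<epsilon>: "\<epsilon> > 0"
    and bound: "ae_near_0 (\<lambda>x. Re (q x) \<ge> ?B N \<epsilon> x)" by blast
  have "\<forall>\<^sub>F x in at_right 0. comparison_potential \<alpha> N x \<le> ?B N \<epsilon> x"
    using comparison_potential_le[OF N \<epsilon>, of \<alpha>] by (simp only: log_weight_sum_def log_weight_def)
  then have "\<forall>\<^sub>F x in at_right 0. ?B N \<epsilon> x \<le> Re (q x) \<longrightarrow> comparison_potential \<alpha> N x \<le> Re (q x)"
    by eventually_elim (blast intro: order_trans)
  from comparison_criterion[OF assms ae_near_0_mono[OF bound this]]
  show "nonoscillatory_at_0 \<alpha> q b \<and> limit_point_at_0 \<alpha> q b" .
qed

end
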